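(* Let $X$ be a transient Lévy process in $\mathbb{R}^d$ such that $\{0\}$ is polar and $G^0(dz)$ tends to zero at infinity. Then a Borel function $q:\mathbb{R}^d\to\mathbb{R}$ belongs to $\mathbb{K}(X)$ if and only if $$\lim_{r\to0^+}\Big[\sup_{x\in\mathbb{R}^d}\int_{B(0,r)}|q(z+x)|\,G^0(dz)\Big]=0,$$ i.e. $\mathcal{K}^0(X)=\mathcal{K}(X)=\mathbb{K}(X)$.
   Context: $\mathbb{P}^x,\mathbb{E}^x$: law and expectation of $X$ started at $x$; $B(x,r)$ is the open Euclidean ball. $\{0\}$ is polar if $\mathbb{P}^x(X_t=0\text{ for some }t>0)=0$ for all $x\in\mathbb{R}^d$. $G^0(B)=\int_0^\infty\mathbb{P}^0(X_u\in B)\,du$ is the potential measure; it tends to zero at infinity if $\lim_{|x|\to\infty}\int_{\mathbb{R}^d}f(z+x)\,G^0(dz)=0$ for all $f\in C_c(\mathbb{R}^d)$. All $q:\mathbb{R}^d\to\mathbb{R}$ are Borel. $\mathcal{K}^0(X)$ is the set of $q$ satisfying the displayed condition in the claim. $\mathbb{K}(X)$ is the set of $q$ with $\lim_{t\to0^+}\sup_x\mathbb{E}^x\int_0^t|q(X_u)|du=0$. $\mathcal{K}(X)$ is the set of $q$ such that for some (equivalently every) $\lambda>0$, $\lim_{r\to0^+}\sup_x\mathbb{E}^x\int_0^\infty e^{-\lambda u}\mathbf 1_{B(x,r)}(X_u)|q(X_u)|du=0$. *)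

theory Defs
  imports "HOL-Probability.Probability"
begin

definition cadlag :: "(real \<Rightarrow> 'a::topological_space) \<Rightarrow> bool" where
  "cadlag f \<longleftrightarrow>
     (\<forall>t\<ge>0. (f \<longlongrightarrow> f t) (at_right t)) \<and> (\<forall>t>0. \<exists>l. (f \<longlongrightarrow> l) (at_left t))"

text \<open>
  A Levy process indexed by times \<open>t \<ge> 0\<close> (the values \<open>X t\<close> for \<open>t < 0\<close> are irrelevant).
  The measure \<open>M\<close> is the law of the process started at 0. Stochastic continuity
  need not be listed: it follows from stationarity and right-continuity of the paths.
\<close>

locale levy_process = prob_space M
  for M :: "'w measure" and X :: "real \<Rightarrow> 'w \<Rightarrow> 'a::euclidean_space" +
  assumes random_variable_X: "\<And>t. 0 \<le> t \<Longrightarrow> X t \<in> borel_measurable M"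
    and X_0: "AE \<omega> in M. X 0 \<omega> = 0"
    and indep_increments:
      "\<And>(n::nat) (t::nat \<Rightarrow> real). 0 \<le> t 0 \<Longrightarrow> strict_mono_on {..n} t \<Longrightarrow>
         indep_vars (\<lambda>_. borel) (\<lambda>i \<omega>. X (t (Suc i)) \<omega> - X (t i) \<omega>) {..<n}"
    and stationary_increments:
      "\<And>s t. 0 \<le> s \<Longrightarrow> 0 \<le> t \<Longrightarrow>
         distr M borel (\<lambda>\<omega>. X (s + t) \<omega> - X s \<omega>) = distr M borel (X t)"
    and cadlag_paths: "AE \<omega> in M. cadlag (\<lambda>t. X t \<omega>)"

text \<open>
  The law \<open>P\<^sup>x\<close> is the law of the translated path \<open>x + X\<close>. The next two definitions give
  \<open>P\<^sup>x\<close>-almost sure events and \<open>E\<^sup>x\<close> of nonnegative functionals of the path.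
\<close>

definition AE_from ::
  "'w measure \<Rightarrow> (real \<Rightarrow> 'w \<Rightarrow> 'a) \<Rightarrow> 'a::euclidean_space \<Rightarrow> ((real \<Rightarrow> 'a) \<Rightarrow> bool) \<Rightarrow> bool" where
  "AE_from M X x P \<longleftrightarrow> (AE \<omega> in M. P (\<lambda>t. x + X t \<omega>))"

definition expectation_from ::
  "'w measure \<Rightarrow> (real \<Rightarrow> 'w \<Rightarrow> 'a) \<Rightarrow> 'a::euclidean_space \<Rightarrow> ((real \<Rightarrow> 'a) \<Rightarrow> ennreal) \<Rightarrow> ennreal" where
  "expectation_from M X x F = (\<integral>\<^sup>+ \<omega>. F (\<lambda>t. x + X t \<omega>) \<partial>M)"

definition transient :: "'w measure \<Rightarrow> (real \<Rightarrow> 'w \<Rightarrow> 'a::euclidean_space) \<Rightarrow> bool" where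
  "transient M X \<longleftrightarrow> (AE \<omega> in M. filterlim (\<lambda>t. norm (X t \<omega>)) at_top at_top)"

definition zero_polar :: "'w measure \<Rightarrow> (real \<Rightarrow> 'w \<Rightarrow> 'a::euclidean_space) \<Rightarrow> bool" where
  "zero_polar M X \<longleftrightarrow> (\<forall>x. AE_from M X x (\<lambda>Y. \<not> (\<exists>t>0. Y t = 0)))"

text \<open>
  \<open>measure_of\<close> yields the zero measure if the given set function is not countably additive;
  lemma \<open>emeasure_potential_measure\<close> below shows that this does not happen here.
\<close>

definition potential_measure ::
  "'w measure \<Rightarrow> (real \<Rightarrow> 'w \<Rightarrow> 'a::euclidean_space) \<Rightarrow> 'a measure" where
  "potential_measure M X = measure_of UNIV (sets borel)
     (\<lambda>B. \<integral>\<^sup>+ u\<in>{0..}. emeasure M {\<omega> \<in> space M. X u \<omega> \<in> B} \<partial>lborel)"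

definition tends_to_zero_at_infinity :: "'a::euclidean_space measure \<Rightarrow> bool" where
  "tends_to_zero_at_infinity G \<longleftrightarrow>
     (\<forall>f :: 'a \<Rightarrow> real. continuous_on UNIV f \<and> compact (closure {z. f z \<noteq> 0}) \<longrightarrow>
        ((\<lambda>x. \<integral>z. f (z + x) \<partial>G) \<longlongrightarrow> 0) at_infinity)"

text \<open>
  \<open>kato_potential\<close>, \<open>kato_resolvent\<close> and \<open>kato_semigroup\<close> are the classes written calligraphic
  \<open>K\<^sup>0(X)\<close>, calligraphic \<open>K(X)\<close> and blackboard-bold \<open>K(X)\<close>.
\<close>

definition kato_potential ::
  "'w measure \<Rightarrow> (real \<Rightarrow> 'w \<Rightarrow> 'a::euclidean_space) \<Rightarrow> ('a \<Rightarrow> real) set" where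
  "kato_potential M X = {q \<in> borel_measurable borel.
     ((\<lambda>r. \<Squnion>x. \<integral>\<^sup>+ z\<in>ball 0 r. ennreal \<bar>q (z + x)\<bar> \<partial>potential_measure M X) \<longlongrightarrow> 0) (at_right 0)}"

definition kato_resolvent ::
  "'w measure \<Rightarrow> (real \<Rightarrow> 'w \<Rightarrow> 'a::euclidean_space) \<Rightarrow> ('a \<Rightarrow> real) set" where
  "kato_resolvent M X = {q \<in> borel_measurable borel. \<exists>c>0.
     ((\<lambda>r. \<Squnion>x. expectation_from M X x (\<lambda>Y.
         \<integral>\<^sup>+ u\<in>{0..}. ennreal (exp (- c * u)) * indicator (ball x r) (Y u) * ennreal \<bar>q (Y u)\<bar> \<partial>lborel))
       \<longlongrightarrow> 0) (at_right (0::real))}"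

definition kato_semigroup ::
  "'w measure \<Rightarrow> (real \<Rightarrow> 'w \<Rightarrow> 'a::euclidean_space) \<Rightarrow> ('a \<Rightarrow> real) set" where
  "kato_semigroup M X = {q \<in> borel_measurable borel.
     ((\<lambda>t. \<Squnion>x. expectation_from M X x (\<lambda>Y. \<integral>\<^sup>+ u\<in>{0..t}. ennreal \<bar>q (Y u)\<bar> \<partial>lborel))
       \<longlongrightarrow> 0) (at_right (0::real))}"

lemma (in levy_process) measurable_emeasure_X:
  assumes B: "B \<in> sets borel"
  shows "(\<lambda>u. emeasure M {\<omega> \<in> space M. X (max 0 u) \<omega> \<in> B}) \<in> borel_measurable lborel"
proof -
  define K where "K u = distr M borel (X (max 0 u))" for u
  have rv [measurable]: "X (max 0 u) \<in> borel_measurable M" for u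
    by (rule random_variable_X) simp
  have cont: "(\<lambda>u. \<integral>\<^sup>+ \<omega>. ennreal (f (X (max 0 u) \<omega>)) \<partial>M) \<in> borel_measurable lborel"
    if f: "continuous_on UNIV f" "\<And>x. 0 \<le> f x \<and> f x \<le> 1" for f :: "'a \<Rightarrow> real"
  proof -
    have [measurable]: "f \<in> borel_measurable borel"
      using f(1) by (rule borel_measurable_continuous_onI)
    define v where "v n u = (real_of_int \<lfloor>real (Suc n) * u\<rfloor> + 1) / real (Suc n)" for n u
    have vgt: "v n u > u" for n u
      unfolding v_def by (simp add: field_simps del: of_nat_Suc) linarith
    have vlt: "v n u \<le> u + 1 / real (Suc n)" for n u
      unfolding v_def by (simp add: field_simps del: of_nat_Suc)
    have vlim: "(\<lambda>n. v n u) \<longlonglongrightarrow> u" for u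
    proof (rule tendsto_sandwich[OF always_eventually always_eventually])
      show "\<forall>n. u \<le> v n u" using vgt by (simp add: less_imp_le)
      show "\<forall>n. v n u \<le> u + 1 / real (Suc n)" using vlt by simp
      show "(\<lambda>n. u + 1 / real (Suc n)) \<longlonglongrightarrow> u"
        using tendsto_add[OF tendsto_const[of u] LIMSEQ_inverse_real_of_nat]
        by (simp add: inverse_eq_divide)
    qed simp
    define g where "g u = (\<integral>\<^sup>+ \<omega>. ennreal (f (X (max 0 u) \<omega>)) \<partial>M)" for u
    have meas: "(\<lambda>u. g (v n (max 0 u))) \<in> borel_measurable lborel" for n
    proof -
      have "(\<lambda>k::int. g ((real_of_int k + 1) / real (Suc n))) \<circ> (\<lambda>u. \<lfloor>real (Suc n) * max 0 u\<rfloor>)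
              \<in> borel_measurable borel"
        by (rule measurable_comp[where N = "count_space UNIV"]) measurable
      then show ?thesis by (simp add: v_def comp_def)
    qed
    have lim: "(\<lambda>n. g (v n (max 0 u))) \<longlonglongrightarrow> g u" for u
      unfolding g_def
    proof (rule nn_integral_dominated_convergence[where w = "\<lambda>_. 1"])
      show "AE \<omega> in M. (\<lambda>n. ennreal (f (X (max 0 (v n (max 0 u))) \<omega>))) \<longlonglongrightarrow>
              ennreal (f (X (max 0 u) \<omega>))"
        using cadlag_paths
      proof eventually_elim
        case (elim \<omega>)
        have "filterlim (\<lambda>n. v n (max 0 u)) (at_right (max 0 u)) sequentially"
          using vlim[of "max 0 u"] vgt less_imp_neq[OF vgt, THEN not_sym] by (auto simp: filterlim_at)
        moreover have "((\<lambda>t. X t \<omega>) \<longlongrightarrow> X (max 0 u) \<omega>) (at_right (max 0 u))"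
          using elim by (simp add: cadlag_def)
        ultimately have "(\<lambda>n. X (v n (max 0 u)) \<omega>) \<longlonglongrightarrow> X (max 0 u) \<omega>"
          by (rule filterlim_compose[rotated])
        moreover have "max 0 (v n (max 0 u)) = v n (max 0 u)" for n
          using vgt[of "max 0 u" n] by simp
        moreover have "isCont f (X (max 0 u) \<omega>)"
          using f(1) by (simp add: continuous_on_eq_continuous_at)
        ultimately show ?case
          by (auto intro!: tendsto_ennrealI isCont_tendsto_compose[where g = f])
      qed
    qed (simp_all add: f(2) emeasure_space_1 ennreal_le_1)
    show ?thesis
      by (rule borel_measurable_LIMSEQ_order[OF lim[unfolded g_def] meas[unfolded g_def]])
  qed
  have "K \<in> measurable lborel (subprob_algebra borel)"
  proof (rule measurable_subprob_algebra_generated[where \<Omega> = UNIV and G = "Collect open"])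
    show "subprob_space (K u)" for u
      unfolding K_def by (intro prob_space_imp_subprob_space prob_space_distr rv)
    show one: "(\<lambda>u. emeasure (K u) UNIV) \<in> borel_measurable lborel"
      unfolding K_def by (simp add: emeasure_distr emeasure_space_1)
    show "sets borel = sigma_sets (UNIV :: 'a set) (Collect open)"
      by (simp add: borel_def)
    show "Int_stable (Collect open :: 'a set set)"
      by (simp add: Int_stable_def open_Int)
    show "sets (K u) = sets borel" for u
      by (simp add: K_def)
    fix U :: "'a set" assume "U \<in> Collect open"
    then have U: "open U" by simp
    then have [measurable]: "U \<in> sets borel" by simp
    show "(\<lambda>u. emeasure (K u) U) \<in> borel_measurable lborel"
    proof (cases "U = UNIV")
      case True then show ?thesis using one by simp
    next
      case False
      define f where "f k x = min 1 (real k * infdist x (- U))" for k x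
      have fc: "continuous_on UNIV (f k)" for k
        unfolding f_def by (intro continuous_intros)
      then have [measurable]: "f k \<in> borel_measurable borel" for k
        by (rule borel_measurable_continuous_onI)
      have f01: "0 \<le> f k x \<and> f k x \<le> 1" for k x
        by (simp add: f_def infdist_nonneg)
      have flim: "(\<lambda>k. ennreal (f k x)) \<longlonglongrightarrow> indicator U x" for x
      proof (cases "x \<in> U")
        case True
        have "infdist x (- U) \<noteq> 0"
          using U True False in_closed_iff_infdist_zero[of "- U" x] by auto
        then have pos: "infdist x (- U) > 0"
          using infdist_nonneg[of x "- U"] by linarith
        then obtain N where N: "1 / infdist x (- U) < real N"
          using reals_Archimedean2 by blast
        have "f k x = 1" if "k \<ge> N" for k
        proof -
          have "1 / infdist x (- U) \<le> real k" using N that by linarith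
          then show ?thesis using pos by (simp add: f_def field_simps)
        qed
        then have "eventually (\<lambda>k. ennreal (f k x) = 1) sequentially"
          by (auto simp: eventually_sequentially)
        then show ?thesis using True by (simp add: tendsto_eventually)
      qed (simp add: f_def)
      have "(\<lambda>k. \<integral>\<^sup>+ \<omega>. ennreal (f k (X (max 0 u) \<omega>)) \<partial>M) \<longlonglongrightarrow> emeasure (K u) U" for u
      proof -
        have "(\<lambda>k. \<integral>\<^sup>+ \<omega>. ennreal (f k (X (max 0 u) \<omega>)) \<partial>M) \<longlonglongrightarrow>
                (\<integral>\<^sup>+ \<omega>. indicator U (X (max 0 u) \<omega>) \<partial>M)"
          by (rule nn_integral_dominated_convergence[where w = "\<lambda>_. 1"])
             (simp_all add: f01 flim emeasure_space_1 ennreal_le_1)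
        also have "(\<integral>\<^sup>+ \<omega>. indicator U (X (max 0 u) \<omega>) \<partial>M) = emeasure (K u) U"
          unfolding K_def using nn_integral_distr[OF rv, of "indicator U" u] by simp
        finally show ?thesis .
      qed
      then show ?thesis
        by (rule borel_measurable_LIMSEQ_order[OF _ cont[OF fc f01]])
    qed
  qed simp
  then have "(\<lambda>u. emeasure (K u) B) \<in> borel_measurable lborel"
    using B by (rule measurable_emeasure_kernel)
  moreover have "emeasure (K u) B = emeasure M {\<omega> \<in> space M. X (max 0 u) \<omega> \<in> B}" for u
    using B by (auto simp: K_def emeasure_distr vimage_def Int_def intro!: arg_cong[where f = "emeasure M"])
  ultimately show ?thesis by simp
qed

lemma sets_potential_measure [simp, measurable_cong]: "sets (potential_measure M X) = sets borel"
  using sets.sets_measure_of_eq[of borel] by (simp add: potential_measure_def)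

lemma (in levy_process) emeasure_potential_measure:
  assumes B: "B \<in> sets borel"
  shows "emeasure (potential_measure M X) B =
           (\<integral>\<^sup>+ u\<in>{0..}. emeasure M {\<omega> \<in> space M. X u \<omega> \<in> B} \<partial>lborel)"
proof (rule emeasure_measure_of[OF potential_measure_def])
  let ?\<mu> = "\<lambda>B. \<integral>\<^sup>+ u\<in>{0..}. emeasure M {\<omega> \<in> space M. X u \<omega> \<in> B} \<partial>lborel"
  show "positive (sets (potential_measure M X)) ?\<mu>" by (simp add: positive_def)
  show "countably_additive (sets (potential_measure M X)) ?\<mu>"
  proof (rule countably_additiveI)
    fix A :: "nat \<Rightarrow> 'a set"
    assume A: "range A \<subseteq> sets (potential_measure M X)" "disjoint_family A"
    have max: "?\<mu> B = (\<integral>\<^sup>+ u\<in>{0..}. emeasure M {\<omega> \<in> space M. X (max 0 u) \<omega> \<in> B} \<partial>lborel)" for B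
      by (rule nn_integral_cong) (simp split: split_indicator)
    have [measurable]: "X (max 0 u) \<in> borel_measurable M" for u
      by (rule random_variable_X) simp
    have [measurable]: "A i \<in> sets borel" for i using A(1) by auto
    have sum: "(\<Sum>i. emeasure M {\<omega> \<in> space M. X (max 0 u) \<omega> \<in> A i}) =
            emeasure M {\<omega> \<in> space M. X (max 0 u) \<omega> \<in> \<Union>(range A)}" for u
    proof -
      have "(\<Sum>i. emeasure M {\<omega> \<in> space M. X (max 0 u) \<omega> \<in> A i}) =
              emeasure M (\<Union>i. {\<omega> \<in> space M. X (max 0 u) \<omega> \<in> A i})"
        using A(2) by (intro suminf_emeasure) (auto simp: disjoint_family_on_def)
      also have "(\<Union>i. {\<omega> \<in> space M. X (max 0 u) \<omega> \<in> A i}) =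
                   {\<omega> \<in> space M. X (max 0 u) \<omega> \<in> \<Union>(range A)}" by auto
      finally show ?thesis .
    qed
    have [measurable]:
      "(\<lambda>u. emeasure M {\<omega> \<in> space M. X (max 0 u) \<omega> \<in> A i}) \<in> borel_measurable borel" for i
      using measurable_emeasure_X[of "A i"] by simp
    have "(\<Sum>i. ?\<mu> (A i)) = (\<integral>\<^sup>+ u. (\<Sum>i.
            emeasure M {\<omega> \<in> space M. X (max 0 u) \<omega> \<in> A i} * indicator {0..} u) \<partial>lborel)"
      unfolding max by (rule nn_integral_suminf[symmetric]) measurable
    also have "\<dots> = ?\<mu> (\<Union>(range A))"
      unfolding max by (rule nn_integral_cong) (simp only: ennreal_suminf_multc sum)
    finally show "(\<Sum>i. ?\<mu> (A i)) = ?\<mu> (\<Union>(range A))" .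
  qed
qed (simp_all add: B)

end

theory Submission
  imports Defs
begin

text \<open>
  The key estimate bounds the mean of \<open>\<integral> g(X\<^sub>u) du\<close> over the times \<open>u \<in> [a, b]\<close> at which the
  process is in an open set \<open>U\<close> by the probability of visiting \<open>U\<close> times the supremum over starting
  points in \<open>U\<close>: apply the Markov property at the first visit to \<open>U\<close> along the grid of mesh
  \<open>2\<^sup>-\<^sup>n\<close> and let \<open>n\<close> tend to infinity.

  From the resolvent to the semigroup condition, \<open>U\<close> is the complement of a ball around the starting
  point, which is visited before a small time with probability at most 1/2, so that the
  contribution from \<open>U\<close> is absorbed on the left (after truncating \<open>q\<close> to make it finite).

  From the semigroup to the potential condition, \<open>U\<close> is a small ball. By transience, the
  probability of returning to it after a large time is at most 1/2, and absorption again bounds the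
  potential of \<open>q\<close> restricted to the ball. The occupation before a small time \<open>t\<close> is controlled by
  the semigroup condition, and the probability of visiting \<open>B(0,r)\<close> after time \<open>t\<close> vanishes as
  \<open>r\<close> tends to 0, by transience and polarity. The last point requires excluding left limits equal to
  0, that is, a form of quasi-left-continuity.
\<close>

section \<open>The Markov property on a grid\<close>

text \<open>The path properties are imposed at every \<omega> and every real time, so that pathwise
  arguments and joint measurability in time and \<omega> need no exceptional set.
  \<open>regular_modification\<close> supplies such a version of any Levy process.\<close>

locale regular_levy_process = levy_process M X
  for M :: "'w measure" and X :: "real \<Rightarrow> 'w \<Rightarrow> 'a::euclidean_space" +
  assumes X_nonpos: "t \<le> 0 \<Longrightarrow> X t \<omega> = 0"
    and right_continuous: "((\<lambda>u. X u \<omega>) \<longlongrightarrow> X t \<omega>) (at_right t)"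
begin

lemma X_measurable: "X t \<in> borel_measurable M"
proof (cases "0 \<le> t")
  case False
  then have "X t = (\<lambda>_. 0)"
    by (intro ext X_nonpos) simp
  then show ?thesis by simp
qed (rule random_variable_X)

text \<open>By right-continuity, \<open>X\<close> at time \<open>u\<close> is the limit of
  \<open>X\<close> at grid times to the right of \<open>u\<close>. Each approximation takes its time
  from a countable set, hence is jointly measurable.\<close>

lemma X_measurable_pair: "(\<lambda>p. X (fst p) (snd p)) \<in> borel_measurable (borel \<Otimes>\<^sub>M M)"
proof (rule borel_measurable_LIMSEQ_metric)
  \<comment> \<open>The \<open>+ 1\<close> puts \<open>v n u\<close> strictly to the right of
    \<open>u\<close>, as convergence along \<open>at_right\<close> requires.\<close>
  define v where "v n u = (real_of_int \<lfloor>real (Suc n) * u\<rfloor> + 1) / real (Suc n)" for n u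
  have vgt: "v n u > u" for n u
    unfolding v_def by (simp add: field_simps del: of_nat_Suc) linarith
  have vle: "v n u \<le> u + 1 / real (Suc n)" for n u
    unfolding v_def by (simp add: field_simps del: of_nat_Suc)
  have vlim: "(\<lambda>n. v n u) \<longlonglongrightarrow> u" for u
  proof (rule tendsto_sandwich[OF always_eventually always_eventually])
    show "\<forall>n. u \<le> v n u" using vgt by (simp add: less_imp_le)
    show "\<forall>n. v n u \<le> u + 1 / real (Suc n)" using vle by simp
    show "(\<lambda>n. u + 1 / real (Suc n)) \<longlonglongrightarrow> u"
      using tendsto_add[OF tendsto_const[of u] LIMSEQ_inverse_real_of_nat]
      by (simp add: inverse_eq_divide)
  qed simp
  fix n :: nat
  note X_measurable[measurable]
  have "(\<lambda>p. X ((real_of_int (\<lfloor>real (Suc n) * fst p\<rfloor>) + 1) / real (Suc n)) (snd p))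
          \<in> borel_measurable (borel \<Otimes>\<^sub>M M)"
    by (rule measurable_compose_countable) measurable
  then show "(\<lambda>p. X (v n (fst p)) (snd p)) \<in> borel_measurable (borel \<Otimes>\<^sub>M M)"
    by (simp add: v_def)
  fix p :: "real \<times> 'w"
  have "filterlim (\<lambda>n. v n (fst p)) (at_right (fst p)) sequentially"
    using vlim[of "fst p"] vgt less_imp_neq[OF vgt, THEN not_sym] by (auto simp: filterlim_at)
  then show "(\<lambda>n. X (v n (fst p)) (snd p)) \<longlonglongrightarrow> X (fst p) (snd p)"
    by (rule filterlim_compose[OF right_continuous])
qed

lemma X_measurable_comp [measurable (raw)]:
  assumes "f \<in> borel_measurable N" "g \<in> measurable N M"
  shows "(\<lambda>x. X (f x) (g x)) \<in> borel_measurable N"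
  using measurable_compose[OF measurable_Pair[OF assms] X_measurable_pair] by simp

text \<open>The first \<open>k\<close> increments are independent of the next one, so the joint law
  is a product and Tonelli applies; stationarity then replaces the last increment by
  \<open>X\<close> at the length of the last step.\<close>

lemma markov_increments:
  assumes t: "t (0::nat) = 0" "strict_mono_on {..Suc k} t"
    and F [measurable]: "F \<in> borel_measurable ((\<Pi>\<^sub>M i\<in>{..<k}. borel) \<Otimes>\<^sub>M borel)"
  shows "(\<integral>\<^sup>+\<omega>. F (\<lambda>i\<in>{..<k}. X (t (Suc i)) \<omega> - X (t i) \<omega>, X (t (Suc k)) \<omega> - X (t k) \<omega>) \<partial>M) =
         (\<integral>\<^sup>+\<omega>. (\<integral>\<^sup>+\<omega>'. F (\<lambda>i\<in>{..<k}. X (t (Suc i)) \<omega> - X (t i) \<omega>, X (t (Suc k) - t k) \<omega>') \<partial>M) \<partial>M)"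
proof -
  define Y where "Y i \<omega> = X (t (Suc i)) \<omega> - X (t i) \<omega>" for i \<omega>
  have Y [measurable]: "Y i \<in> borel_measurable M" for i
    unfolding Y_def by measurable
  have tk: "0 \<le> t k" "t k < t (Suc k)"
    using t strict_mono_onD[OF t(2), of 0 k] strict_mono_onD[OF t(2), of k "Suc k"]
    by (cases "k = 0"; simp)+
  have ind: "indep_vars (\<lambda>_. borel) Y {..<Suc k}"
    using indep_increments[of t "Suc k"] t by (simp add: Y_def[abs_def])
  \<comment> \<open>Grouping the indices into \<open>{..<k}\<close> and \<open>{k}\<close> gives
    independent blocks; the second is a function on a singleton, hence the evaluations
    \<open>snd p k\<close> and \<open>z k\<close> below.\<close>
  have iv: "indep_var (\<Pi>\<^sub>M i\<in>{..<k}. borel) (\<lambda>\<omega>. \<lambda>i\<in>{..<k}. Y i \<omega>)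
                  (\<Pi>\<^sub>M i\<in>{k}. borel) (\<lambda>\<omega>. \<lambda>i\<in>{k}. Y i \<omega>)"
    by (rule indep_var_restrict[OF ind]) auto
  have st: "distr M borel (Y k) = distr M borel (X (t (Suc k) - t k))"
    using stationary_increments[of "t k" "t (Suc k) - t k"] tk by (simp add: Y_def[abs_def])
  let ?P = "\<Pi>\<^sub>M i\<in>{..<k}. (borel :: 'a measure)"
  let ?W = "\<lambda>\<omega>. \<lambda>i\<in>{..<k}. Y i \<omega>"
  let ?Q = "\<Pi>\<^sub>M i\<in>{k}. (borel :: 'a measure)"
  let ?Z = "\<lambda>\<omega>. \<lambda>i\<in>{k}. Y i \<omega>"
  interpret D: prob_space "distr M ?Q ?Z"
    by (rule prob_space_distr) measurable
  have "(\<integral>\<^sup>+\<omega>. F (?W \<omega>, Y k \<omega>) \<partial>M) =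
      (\<integral>\<^sup>+p. F (fst p, snd p k) \<partial>distr M (?P \<Otimes>\<^sub>M ?Q) (\<lambda>\<omega>. (?W \<omega>, ?Z \<omega>)))"
    by (subst nn_integral_distr) simp_all
  also have "distr M (?P \<Otimes>\<^sub>M ?Q) (\<lambda>\<omega>. (?W \<omega>, ?Z \<omega>)) = distr M ?P ?W \<Otimes>\<^sub>M distr M ?Q ?Z"
    using iv unfolding indep_var_distribution_eq by simp
  also have "(\<integral>\<^sup>+p. F (fst p, snd p k) \<partial>\<dots>) =
      (\<integral>\<^sup>+w. (\<integral>\<^sup>+z. F (w, z k) \<partial>distr M ?Q ?Z) \<partial>distr M ?P ?W)"
    by (subst D.nn_integral_fst[symmetric]) simp_all
  also have "\<dots> = (\<integral>\<^sup>+w. (\<integral>\<^sup>+\<omega>'. F (w, Y k \<omega>') \<partial>M) \<partial>distr M ?P ?W)"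
    by (intro nn_integral_cong, subst nn_integral_distr) (auto simp: space_PiM)
  also have "\<dots> = (\<integral>\<^sup>+w. (\<integral>\<^sup>+\<omega>'. F (w, X (t (Suc k) - t k) \<omega>') \<partial>M) \<partial>distr M ?P ?W)"
  proof (rule nn_integral_cong)
    fix w assume "w \<in> space (distr M ?P ?W)"
    then have [measurable]: "w \<in> space ?P" by simp
    have "(\<integral>\<^sup>+\<omega>'. F (w, Y k \<omega>') \<partial>M) = (\<integral>\<^sup>+z. F (w, z) \<partial>distr M borel (Y k))"
      by (subst nn_integral_distr) simp_all
    also have "\<dots> = (\<integral>\<^sup>+\<omega>'. F (w, X (t (Suc k) - t k) \<omega>') \<partial>M)"
      unfolding st by (subst nn_integral_distr) simp_all
    finally show "(\<integral>\<^sup>+\<omega>'. F (w, Y k \<omega>') \<partial>M) = (\<integral>\<^sup>+\<omega>'. F (w, X (t (Suc k) - t k) \<omega>') \<partial>M)" .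
  qed
  also have "\<dots> = (\<integral>\<^sup>+\<omega>. (\<integral>\<^sup>+\<omega>'. F (?W \<omega>, X (t (Suc k) - t k) \<omega>') \<partial>M) \<partial>M)"
    by (subst nn_integral_distr) simp_all
  finally show ?thesis
    unfolding Y_def .
qed

text \<open>Simple Markov property at time \<open>k * e\<close> for the history along the grid:
  positions are partial sums of increments, so \<open>markov_increments\<close> applies to the grid
  followed by the time \<open>k * e + s\<close>.\<close>

lemma markov_grid:
  assumes e: "0 < e" and s: "0 \<le> s"
    and F [measurable]: "F \<in> borel_measurable ((\<Pi>\<^sub>M i\<in>{..k}. borel) \<Otimes>\<^sub>M borel)"
  shows "(\<integral>\<^sup>+\<omega>. F (\<lambda>i\<in>{..k}. X (real i * e) \<omega>, X (real k * e + s) \<omega> - X (real k * e) \<omega>) \<partial>M) =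
         (\<integral>\<^sup>+\<omega>. (\<integral>\<^sup>+\<omega>'. F (\<lambda>i\<in>{..k}. X (real i * e) \<omega>, X s \<omega>') \<partial>M) \<partial>M)"
\<comment> \<open>For \<open>s = 0\<close> the extended grid is not strictly increasing, but then
  the second argument of \<open>F\<close> is 0 on both sides.\<close>
proof (cases "s = 0")
  case True
  then show ?thesis by (simp add: X_nonpos emeasure_space_1)
next
  case False
  define t where "t i = (if i \<le> k then real i * e else real k * e + s)" for i
  have t0: "t 0 = 0" by (simp add: t_def)
  have mono: "strict_mono_on {..Suc k} t"
  proof (rule strict_mono_onI)
    fix i j assume ij: "i \<in> {..Suc k}" "j \<in> {..Suc k}" "i < j"
    show "t i < t j"
    proof (cases "j \<le> k")
      case True
      then show ?thesis using ij e by (simp add: t_def)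
    next
      case False
      then have "i \<le> k" using ij by simp
      then have "real i * e \<le> real k * e"
        using e by (intro mult_right_mono) auto
      then show ?thesis
        using \<open>i \<le> k\<close> False s \<open>s \<noteq> 0\<close> unfolding t_def by (simp only: if_True if_False)
    qed
  qed
  \<comment> \<open>\<open>S\<close> recovers the grid positions from the increments; the
    telescoping sums start from the value 0 at time 0.\<close>
  define S where "S w = (\<lambda>i\<in>{..k}. \<Sum>j<i. w j :: 'a)" for w
  have S [measurable]: "S \<in> measurable (\<Pi>\<^sub>M i\<in>{..<k}. borel) (\<Pi>\<^sub>M i\<in>{..k}. borel)"
    unfolding S_def
    by (intro measurable_restrict borel_measurable_sum measurable_component_singleton) auto
  have S_eq: "S (\<lambda>i\<in>{..<k}. X (t (Suc i)) \<omega> - X (t i) \<omega>) = (\<lambda>i\<in>{..k}. X (real i * e) \<omega>)" for \<omega>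
    unfolding S_def
  proof (intro restrict_ext)
    fix i assume "i \<in> {..k}"
    then have "(\<Sum>j<i. (\<lambda>i\<in>{..<k}. X (t (Suc i)) \<omega> - X (t i) \<omega>) j) =
                 (\<Sum>j<i. X (t (Suc j)) \<omega> - X (t j) \<omega>)"
      by (intro sum.cong) auto
    also have "\<dots> = X (t i) \<omega>"
      using sum_lessThan_telescope[of "\<lambda>j. X (t j) \<omega>" i] by (simp add: t0 X_nonpos)
    finally show "(\<Sum>j<i. (\<lambda>i\<in>{..<k}. X (t (Suc i)) \<omega> - X (t i) \<omega>) j) = X (real i * e) \<omega>"
      using \<open>i \<in> {..k}\<close> by (simp add: t_def)
  qed
  have "(\<lambda>p. F (S (fst p), snd p)) \<in> borel_measurable ((\<Pi>\<^sub>M i\<in>{..<k}. borel) \<Otimes>\<^sub>M borel)"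
    by measurable
  from markov_increments[OF t0 mono this] show ?thesis
    by (simp add: S_eq) (simp add: t_def)
qed

end

section \<open>Visits to a set along dyadic times\<close>

lemma dyadic_between:
  fixes x y :: real
  assumes "0 \<le> x" "x < y"
  obtains n i where "x < real i / 2 ^ n" "real i / 2 ^ n < y"
proof -
  obtain n where n: "(1/2) ^ n < y - x"
    using real_arch_pow_inv[of "y - x" "1/2"] assms by auto
  define i where "i = nat (\<lfloor>x * 2 ^ n\<rfloor> + 1)"
  have i: "real i = real_of_int \<lfloor>x * 2 ^ n\<rfloor> + 1"
    unfolding i_def using assms(1) by (simp add: of_nat_nat)
  have "x * 2 ^ n < real i" "real i \<le> x * 2 ^ n + 1"
    unfolding i by linarith+
  then have "x < real i / 2 ^ n" "real i / 2 ^ n \<le> x + (1/2) ^ n"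
    by (simp_all add: field_simps power_divide)
  with n show thesis by (intro that[of i n]) auto
qed

context regular_levy_process
begin

text \<open>The expectation stands inside the time integral because the Markov property is applied
  at each fixed \<open>u\<close>; \<open>occupation_path\<close> exchanges the order and gives the
  mean of the integral along the path from \<open>x\<close>.\<close>

definition occupation :: "real set \<Rightarrow> ('a \<Rightarrow> ennreal) \<Rightarrow> 'a \<Rightarrow> ennreal" where
  "occupation I f x = (\<integral>\<^sup>+u\<in>I. (\<integral>\<^sup>+\<omega>. f (x + X u \<omega>) \<partial>M) \<partial>lborel)"

text \<open>Testing dyadic times only makes the event a countable union, measurable for every
  \<open>I\<close>. The path starts at 0, so a visit of the process from \<open>x\<close> to a set
  is a visit to its translate by \<open>- x\<close>.\<close>

definition hits :: "real set \<Rightarrow> 'a set \<Rightarrow> 'w set" where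
  "hits I U = {\<omega> \<in> space M. \<exists>n i. real i / 2 ^ n \<in> I \<and> X (real i / 2 ^ n) \<omega> \<in> U}"

text \<open>Determined by the grid positions up to index \<open>i\<close>, hence accessible to
  \<open>markov_grid\<close>. For fixed \<open>n\<close> the events are disjoint and contained in
  \<open>hits I U\<close>, so their probabilities sum to at most that of
  \<open>hits I U\<close>.\<close>

definition first_hit :: "real set \<Rightarrow> 'a set \<Rightarrow> nat \<Rightarrow> nat \<Rightarrow> 'w set" where
  "first_hit I U n i = {\<omega> \<in> space M. real i / 2 ^ n \<in> I \<and> X (real i / 2 ^ n) \<omega> \<in> U \<and>
     (\<forall>j<i. real j / 2 ^ n \<in> I \<longrightarrow> X (real j / 2 ^ n) \<omega> \<notin> U)}"

lemma sets_hits [measurable]: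
  assumes [measurable]: "U \<in> sets borel"
  shows "hits I U \<in> sets M"
  unfolding hits_def by measurable

lemma sets_first_hit [measurable]:
  assumes [measurable]: "U \<in> sets borel"
  shows "first_hit I U n i \<in> sets M"
  unfolding first_hit_def by measurable

lemma hits_mono: "I \<subseteq> J \<Longrightarrow> U \<subseteq> V \<Longrightarrow> hits I U \<subseteq> hits J V"
  unfolding hits_def by blast

lemma first_hit_subset_hits: "first_hit I U n i \<subseteq> hits I U"
  unfolding first_hit_def hits_def by blast

lemma disjoint_first_hit: "disjoint_family (first_hit I U n)"
proof -
  have "first_hit I U n i \<inter> first_hit I U n j = {}" if "i \<noteq> j" for i j
    using that unfolding first_hit_def by (cases i j rule: linorder_cases) auto
  then show ?thesis by (auto simp: disjoint_family_on_def)
qed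

lemma ex_first_hit:
  assumes "\<omega> \<in> space M" "real k / 2 ^ n \<in> I" "X (real k / 2 ^ n) \<omega> \<in> U"
  shows "\<exists>i\<le>k. \<omega> \<in> first_hit I U n i"
proof -
  define i where "i = (LEAST i. real i / 2 ^ n \<in> I \<and> X (real i / 2 ^ n) \<omega> \<in> U)"
  have "real i / 2 ^ n \<in> I \<and> X (real i / 2 ^ n) \<omega> \<in> U"
    unfolding i_def by (rule LeastI[of _ k]) (use assms in auto)
  moreover have "\<forall>j<i. \<not> (real j / 2 ^ n \<in> I \<and> X (real j / 2 ^ n) \<omega> \<in> U)"
    unfolding i_def using not_less_Least by blast
  moreover have "i \<le> k"
    unfolding i_def by (rule Least_le) (use assms in auto)
  ultimately show ?thesis
    using assms(1) by (auto simp: first_hit_def intro!: exI[of _ i])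
qed

lemma sum_emeasure_first_hit_le:
  assumes [measurable]: "U \<in> sets borel"
  shows "(\<Sum>i. emeasure M (first_hit I U n i)) \<le> emeasure M (hits I U)"
proof -
  have "(\<Sum>i. emeasure M (first_hit I U n i)) = emeasure M (\<Union>i. first_hit I U n i)"
    by (intro suminf_emeasure disjoint_first_hit) auto
  also have "\<dots> \<le> emeasure M (hits I U)"
    by (intro emeasure_mono UN_least first_hit_subset_hits) simp
  finally show ?thesis .
qed

text \<open>The indicator of a first visit at index \<open>k\<close> is a function of the positions
  at indices up to \<open>k\<close>, so it can enter \<open>markov_grid\<close> as a factor of
  \<open>F\<close>.\<close>

lemma markov_first_hit:
  fixes n k :: nat
  assumes [measurable]: "U \<in> sets borel" "h \<in> borel_measurable (borel \<Otimes>\<^sub>M borel)" and s: "0 \<le> s"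
  defines "v \<equiv> \<lambda>i. real i / 2 ^ n"
  shows "(\<integral>\<^sup>+\<omega>. indicator (first_hit I U n k) \<omega> * h (X (v k) \<omega>, X (v k + s) \<omega> - X (v k) \<omega>) \<partial>M) =
         (\<integral>\<^sup>+\<omega>. indicator (first_hit I U n k) \<omega> * (\<integral>\<^sup>+\<omega>'. h (X (v k) \<omega>, X s \<omega>') \<partial>M) \<partial>M)"
proof -
  \<comment> \<open>\<open>A\<close> is the event \<open>first_hit\<close> transported to vectors of
    grid positions.\<close>
  define A where "A = {w \<in> space (\<Pi>\<^sub>M i\<in>{..k}. (borel :: 'a measure)). v k \<in> I \<and> w k \<in> U \<and>
    (\<forall>j\<in>{..<k}. v j \<in> I \<longrightarrow> w j \<notin> U)}"
  have [measurable]: "(\<lambda>w. w j) \<in> measurable (\<Pi>\<^sub>M i\<in>{..k}. (borel :: 'a measure)) borel" if "j \<le> k" for j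
    using that by (intro measurable_component_singleton) auto
  have [measurable]: "(\<lambda>w. w j) \<in> measurable (\<Pi>\<^sub>M i\<in>{..k}. (borel :: 'a measure)) borel" if "j \<in> {..<k}" for j
    using that by (intro measurable_component_singleton) auto
  have [measurable]: "A \<in> sets (\<Pi>\<^sub>M i\<in>{..k}. borel)"
    unfolding A_def by measurable
  have iff: "(\<lambda>i\<in>{..k}. X (v i) \<omega>) \<in> A \<longleftrightarrow> \<omega> \<in> first_hit I U n k" if "\<omega> \<in> space M" for \<omega>
    using that by (auto simp: A_def first_hit_def v_def space_PiM)
  have "(\<lambda>p. indicator A (fst p) * h (fst p k, snd p)) \<in> borel_measurable ((\<Pi>\<^sub>M i\<in>{..k}. borel) \<Otimes>\<^sub>M borel)"
    by measurable
  from markov_grid[OF _ s this, of "1 / 2 ^ n"]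
  have "(\<integral>\<^sup>+\<omega>. indicator A (\<lambda>i\<in>{..k}. X (v i) \<omega>) * h (X (v k) \<omega>, X (v k + s) \<omega> - X (v k) \<omega>) \<partial>M) =
        (\<integral>\<^sup>+\<omega>. (\<integral>\<^sup>+\<omega>'. indicator A (\<lambda>i\<in>{..k}. X (v i) \<omega>) * h (X (v k) \<omega>, X s \<omega>') \<partial>M) \<partial>M)"
    by (simp add: v_def)
  also have "\<dots> = (\<integral>\<^sup>+\<omega>. indicator A (\<lambda>i\<in>{..k}. X (v i) \<omega>) * (\<integral>\<^sup>+\<omega>'. h (X (v k) \<omega>, X s \<omega>') \<partial>M) \<partial>M)"
    by (intro nn_integral_cong nn_integral_cmult) measurable
  also have "(\<integral>\<^sup>+\<omega>. indicator A (\<lambda>i\<in>{..k}. X (v i) \<omega>) * h (X (v k) \<omega>, X (v k + s) \<omega> - X (v k) \<omega>) \<partial>M) =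
     (\<integral>\<^sup>+\<omega>. indicator (first_hit I U n k) \<omega> * h (X (v k) \<omega>, X (v k + s) \<omega> - X (v k) \<omega>) \<partial>M)"
    by (intro nn_integral_cong) (simp add: indicator_def iff)
  also have "(\<integral>\<^sup>+\<omega>. indicator A (\<lambda>i\<in>{..k}. X (v i) \<omega>) * (\<integral>\<^sup>+\<omega>'. h (X (v k) \<omega>, X s \<omega>') \<partial>M) \<partial>M) =
     (\<integral>\<^sup>+\<omega>. indicator (first_hit I U n k) \<omega> * (\<integral>\<^sup>+\<omega>'. h (X (v k) \<omega>, X s \<omega>') \<partial>M) \<partial>M)"
    by (intro nn_integral_cong) (simp add: indicator_def iff)
  finally show ?thesis .
qed

section \<open>Occupation integrals and the hitting estimate\<close>

lemma Fubini_time: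
  assumes [measurable]: "(\<lambda>p. F (fst p) (snd p)) \<in> borel_measurable (borel \<Otimes>\<^sub>M M)"
  shows "(\<integral>\<^sup>+\<omega>. (\<integral>\<^sup>+u. F u \<omega> \<partial>lborel) \<partial>M) = (\<integral>\<^sup>+u. (\<integral>\<^sup>+\<omega>. F u \<omega> \<partial>M) \<partial>(lborel :: real measure))"
proof -
  interpret pair_sigma_finite "lborel :: real measure" M ..
  show ?thesis
    using Fubini'[of F] by (simp add: case_prod_beta')
qed

lemma occupation_path:
  assumes [measurable]: "f \<in> borel_measurable borel" "I \<in> sets borel"
  shows "occupation I f x = (\<integral>\<^sup>+\<omega>. (\<integral>\<^sup>+u\<in>I. f (x + X u \<omega>) \<partial>lborel) \<partial>M)"
  unfolding occupation_def
  by (subst Fubini_time) (simp_all add: nn_integral_multc)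

text \<open>After a restart at the visit time \<open>v k\<close> the remaining horizon is
  \<open>b - v k\<close>, at most \<open>b - a\<close> because \<open>v k\<close> is at least
  \<open>a\<close>, and the new starting point is \<open>x + y\<close> with \<open>y\<close> in
  \<open>U\<close>. So the bound \<open>B\<close> applies on the event of a first visit.\<close>

lemma occupation_after_first_hit:
  fixes n k :: nat
  assumes [measurable]: "U \<in> sets borel" "g \<in> borel_measurable borel"
    and B: "\<And>y. y \<in> U \<Longrightarrow> occupation {0..b - a} g (x + y) \<le> B"
  defines "v \<equiv> \<lambda>i. real i / 2 ^ n"
  shows "(\<integral>\<^sup>+u\<in>{v k..b}. (\<integral>\<^sup>+\<omega>. indicator (first_hit {a..b} U n k) \<omega> * g (x + X u \<omega>) \<partial>M) \<partial>lborel)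
         \<le> emeasure M (first_hit {a..b} U n k) * B"
proof -
  let ?A = "first_hit {a..b} U n k"
  \<comment> \<open>Substitute \<open>u = v k + s\<close>, so that the Markov property applies for
    each fixed \<open>s\<close>.\<close>
  have "(\<integral>\<^sup>+u\<in>{v k..b}. (\<integral>\<^sup>+\<omega>. indicator ?A \<omega> * g (x + X u \<omega>) \<partial>M) \<partial>lborel) =
        (\<integral>\<^sup>+s. (\<integral>\<^sup>+\<omega>. indicator ?A \<omega> * g (x + X (v k + s) \<omega>) \<partial>M) * indicator {0..b - v k} s \<partial>lborel)"
    by (subst nn_integral_real_affine[of _ 1 "v k"])
       (auto intro!: nn_integral_cong split: split_indicator)
  also have "\<dots> = (\<integral>\<^sup>+s. (\<integral>\<^sup>+\<omega>. indicator ?A \<omega> * (\<integral>\<^sup>+\<omega>'. g (x + X (v k) \<omega> + X s \<omega>') \<partial>M) \<partial>M) *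
                     indicator {0..b - v k} s \<partial>lborel)"
  proof (rule nn_integral_cong)
    fix s :: real
    show "(\<integral>\<^sup>+\<omega>. indicator ?A \<omega> * g (x + X (v k + s) \<omega>) \<partial>M) * indicator {0..b - v k} s =
          (\<integral>\<^sup>+\<omega>. indicator ?A \<omega> * (\<integral>\<^sup>+\<omega>'. g (x + X (v k) \<omega> + X s \<omega>') \<partial>M) \<partial>M) * indicator {0..b - v k} s"
      using markov_first_hit[of U "\<lambda>p. g (x + fst p + snd p)" s "{a..b}" n k]
      by (cases "0 \<le> s") (simp_all add: v_def)
  qed
  also have "\<dots> = (\<integral>\<^sup>+\<omega>. indicator ?A \<omega> * occupation {0..b - v k} g (x + X (v k) \<omega>) \<partial>M)"
  proof -
    let ?F = "\<lambda>s \<omega>. indicator ?A \<omega> * (\<integral>\<^sup>+\<omega>'. g (x + X (v k) \<omega> + X s \<omega>') \<partial>M) * indicator {0..b - v k} s :: ennreal"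
    have "(\<integral>\<^sup>+s. (\<integral>\<^sup>+\<omega>. indicator ?A \<omega> * (\<integral>\<^sup>+\<omega>'. g (x + X (v k) \<omega> + X s \<omega>') \<partial>M) \<partial>M) *
                     indicator {0..b - v k} s \<partial>lborel) = (\<integral>\<^sup>+s. (\<integral>\<^sup>+\<omega>. ?F s \<omega> \<partial>M) \<partial>lborel)"
      by (intro nn_integral_cong nn_integral_multc[symmetric]) measurable
    also have "\<dots> = (\<integral>\<^sup>+\<omega>. (\<integral>\<^sup>+s. ?F s \<omega> \<partial>lborel) \<partial>M)"
      by (rule Fubini_time[symmetric]) measurable
    also have "\<dots> = (\<integral>\<^sup>+\<omega>. indicator ?A \<omega> * occupation {0..b - v k} g (x + X (v k) \<omega>) \<partial>M)"
      unfolding occupation_def mult.assoc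
      by (intro nn_integral_cong nn_integral_cmult) measurable
    finally show ?thesis .
  qed
  also have "\<dots> \<le> (\<integral>\<^sup>+\<omega>. B * indicator ?A \<omega> \<partial>M)"
  proof (rule nn_integral_mono)
    fix \<omega> assume "\<omega> \<in> space M"
    show "indicator ?A \<omega> * occupation {0..b - v k} g (x + X (v k) \<omega>) \<le> B * indicator ?A \<omega>"
    proof (cases "\<omega> \<in> ?A")
      case True
      then have "X (v k) \<omega> \<in> U" "a \<le> v k" by (auto simp: first_hit_def v_def)
      then have "occupation {0..b - v k} g (x + X (v k) \<omega>) \<le> occupation {0..b - a} g (x + X (v k) \<omega>)"
        unfolding occupation_def by (intro nn_integral_mono) (auto split: split_indicator)
      also have "\<dots> \<le> B" by (rule B) fact
      finally show ?thesis using True by simp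
    qed simp
  qed
  also have "\<dots> = emeasure M ?A * B"
    by (simp add: nn_integral_cmult mult.commute)
  finally show ?thesis .
qed

end

lemma ennreal_le_suminf: "f i \<le> (\<Sum>k. f k)" for f :: "nat \<Rightarrow> ennreal"
  using sum_le_suminf[of f "{i}"] by simp

context regular_levy_process
begin

text \<open>Each time \<open>u\<close> in \<open>{a..b}\<close> preceded by a grid visit lies in
  \<open>{v k..b}\<close> for the index \<open>k\<close> of the first such visit. Summing
  \<open>occupation_after_first_hit\<close> over \<open>k\<close> leaves the total probability of
  the first visits.\<close>

lemma grid_hitting_bound:
  fixes n :: nat
  assumes [measurable]: "U \<in> sets borel" "g \<in> borel_measurable borel"
    and B: "\<And>y. y \<in> U \<Longrightarrow> occupation {0..b - a} g (x + y) \<le> B"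
  defines "v \<equiv> \<lambda>i. real i / 2 ^ n"
  shows "(\<integral>\<^sup>+u\<in>{a..b}. (\<integral>\<^sup>+\<omega>. of_bool (\<exists>i. a \<le> v i \<and> v i \<le> u \<and> X (v i) \<omega> \<in> U) * g (x + X u \<omega>) \<partial>M) \<partial>lborel)
         \<le> emeasure M (hits {a..b} U) * B"
proof -
  let ?A = "first_hit {a..b} U n"
  let ?H = "\<lambda>u \<omega>. \<exists>i. a \<le> v i \<and> v i \<le> u \<and> X (v i) \<omega> \<in> U"
  have pt: "indicator {a..b} u * of_bool (?H u \<omega>) \<le> (\<Sum>k. indicator {v k..b} u * indicator (?A k) \<omega> :: ennreal)"
    if "\<omega> \<in> space M" for u \<omega>
  proof (cases "u \<in> {a..b} \<and> ?H u \<omega>")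
    case True
    then obtain k where k: "a \<le> v k" "v k \<le> u" "X (v k) \<omega> \<in> U" by blast
    then obtain i where i: "i \<le> k" "\<omega> \<in> ?A i"
      using ex_first_hit[OF \<open>\<omega> \<in> space M\<close>, of k n "{a..b}" U] True by (auto simp: v_def)
    have "v i \<le> v k" using i(1) by (simp add: v_def divide_right_mono)
    then have "indicator {a..b} u * of_bool (?H u \<omega>) \<le> (indicator {v i..b} u * indicator (?A i) \<omega> :: ennreal)"
      using i k True by simp
    also have "\<dots> \<le> (\<Sum>k. indicator {v k..b} u * indicator (?A k) \<omega> :: ennreal)"
      by (rule ennreal_le_suminf)
    finally show ?thesis .
  qed auto
  have "(\<integral>\<^sup>+u\<in>{a..b}. (\<integral>\<^sup>+\<omega>. of_bool (?H u \<omega>) * g (x + X u \<omega>) \<partial>M) \<partial>lborel) =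
        (\<integral>\<^sup>+u. (\<integral>\<^sup>+\<omega>. indicator {a..b} u * of_bool (?H u \<omega>) * g (x + X u \<omega>) \<partial>M) \<partial>lborel)"
    by (intro nn_integral_cong) (auto split: split_indicator)
  also have "\<dots> \<le> (\<integral>\<^sup>+u. (\<integral>\<^sup>+\<omega>. (\<Sum>k. indicator {v k..b} u * (indicator (?A k) \<omega> * g (x + X u \<omega>))) \<partial>M) \<partial>lborel)"
  proof (intro nn_integral_mono)
    fix u \<omega> assume "\<omega> \<in> space M"
    then have "indicator {a..b} u * of_bool (?H u \<omega>) * g (x + X u \<omega>) \<le>
               (\<Sum>k. indicator {v k..b} u * indicator (?A k) \<omega>) * g (x + X u \<omega>)"
      by (intro mult_right_mono pt) auto
    then show "indicator {a..b} u * of_bool (?H u \<omega>) * g (x + X u \<omega>) \<le>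
               (\<Sum>k. indicator {v k..b} u * (indicator (?A k) \<omega> * g (x + X u \<omega>)))"
      by (simp only: ennreal_suminf_multc[symmetric] mult.assoc)
  qed
  also have "\<dots> = (\<integral>\<^sup>+u. (\<Sum>k. \<integral>\<^sup>+\<omega>. indicator {v k..b} u * (indicator (?A k) \<omega> * g (x + X u \<omega>)) \<partial>M) \<partial>lborel)"
    by (intro nn_integral_cong nn_integral_suminf) measurable
  also have "\<dots> = (\<integral>\<^sup>+u. (\<Sum>k. (\<integral>\<^sup>+\<omega>. indicator (?A k) \<omega> * g (x + X u \<omega>) \<partial>M) * indicator {v k..b} u) \<partial>lborel)"
    by (intro nn_integral_cong suminf_cong) (auto split: split_indicator)
  also have "\<dots> = (\<Sum>k. \<integral>\<^sup>+u. (\<integral>\<^sup>+\<omega>. indicator (?A k) \<omega> * g (x + X u \<omega>) \<partial>M) * indicator {v k..b} u \<partial>lborel)"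
    by (intro nn_integral_suminf) measurable
  also have "\<dots> \<le> (\<Sum>k. emeasure M (?A k) * B)"
    unfolding v_def by (intro suminf_le occupation_after_first_hit B) auto
  also have "\<dots> = (\<Sum>k. emeasure M (?A k)) * B"
    by (rule ennreal_suminf_multc)
  also have "\<dots> \<le> emeasure M (hits {a..b} U) * B"
    by (intro mult_right_mono sum_emeasure_first_hit_le) auto
  finally show ?thesis .
qed

lemma AE_dyadic_hit_before:
  assumes a: "0 \<le> a" and U: "open U"
  shows "AE u in lborel. a \<le> u \<and> X u \<omega> \<in> U \<longrightarrow>
           (\<exists>n i. a \<le> real i / 2 ^ n \<and> real i / 2 ^ n \<le> u \<and> X (real i / 2 ^ n) \<omega> \<in> U)"
proof -
  define N where "N = {u. a \<le> u \<and> X u \<omega> \<in> U \<and>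
    \<not> (\<exists>n i. a \<le> real i / 2 ^ n \<and> real i / 2 ^ n \<le> u \<and> X (real i / 2 ^ n) \<omega> \<in> U)}"
  \<comment> \<open>\<open>N\<close> has at most one element: paths enter \<open>U\<close> at dyadic times right after each of its points.\<close>
  have "\<not> u < w" if "u \<in> N" "w \<in> N" for u w
  proof
    assume "u < w"
    from that have "a \<le> u" "X u \<omega> \<in> U" by (auto simp: N_def)
    have "\<forall>\<^sub>F s in at_right u. X s \<omega> \<in> U"
      using right_continuous[of \<omega> u] U \<open>X u \<omega> \<in> U\<close> by (rule topological_tendstoD)
    then obtain c where c: "c > u" "\<And>s. u < s \<Longrightarrow> s < c \<Longrightarrow> X s \<omega> \<in> U"
      unfolding eventually_at_right_field by blast
    obtain n i where "u < real i / 2 ^ n" "real i / 2 ^ n < min c w"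
      by (rule dyadic_between[of u "min c w"]) (use a \<open>a \<le> u\<close> \<open>u < w\<close> c(1) in auto)
    moreover have "X (real i / 2 ^ n) \<omega> \<in> U"
      using calculation by (intro c(2)) auto
    ultimately have "a \<le> real i / 2 ^ n \<and> real i / 2 ^ n \<le> w \<and> X (real i / 2 ^ n) \<omega> \<in> U"
      using \<open>a \<le> u\<close> by auto
    then show False
      using \<open>w \<in> N\<close> unfolding N_def by blast
  qed
  then have "\<forall>u\<in>N. \<forall>w\<in>N. u = w"
    by (meson linorder_neqE)
  then have "countable N"
    by (cases "N = {}") (auto intro!: countable_subset[of N "{SOME u. u \<in> N}"] some_equality[symmetric])
  then have "N \<in> null_sets lborel"
    by (rule countable_imp_null_set_lborel)
  then show ?thesis
    by (rule AE_I') (auto simp: N_def)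
qed

text \<open>Limit of \<open>grid_hitting_bound\<close> as the mesh tends to 0. The events behind
  \<open>H n\<close> increase since the dyadic grids are nested, and for almost every
  \<open>u\<close> with the path in \<open>U\<close> one of them occurs by
  \<open>AE_dyadic_hit_before\<close>; monotone convergence concludes.\<close>

lemma hitting_bound:
  assumes a: "0 \<le> a" and U: "open U" and [measurable]: "g \<in> borel_measurable borel"
    and B: "\<And>y. y \<in> U \<Longrightarrow> occupation {0..b - a} g (x + y) \<le> B"
  shows "occupation {a..b} (\<lambda>z. indicator U (z - x) * g z) x \<le> emeasure M (hits {a..b} U) * B"
proof -
  have [measurable]: "U \<in> sets borel" using U by simp
  define H where "H n u \<omega> = (of_bool (\<exists>i. a \<le> real i / 2 ^ n \<and> real i / 2 ^ n \<le> u \<and> X (real i / 2 ^ n) \<omega> \<in> U) :: ennreal)"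
    for n :: nat and u \<omega>
  have [measurable]: "(\<lambda>p. H n (fst p) (snd p)) \<in> borel_measurable (borel \<Otimes>\<^sub>M M)" for n
    unfolding H_def of_bool_def by measurable
  have [measurable]: "H n u \<in> borel_measurable M" for n u
    unfolding H_def of_bool_def by measurable
  have inc: "H n u \<omega> \<le> H (Suc n) u \<omega>" for n u \<omega>
  proof -
    have "real i / 2 ^ n = real (2 * i) / 2 ^ Suc n" for i by simp
    then have "(\<exists>i. a \<le> real i / 2 ^ n \<and> real i / 2 ^ n \<le> u \<and> X (real i / 2 ^ n) \<omega> \<in> U) \<Longrightarrow>
          (\<exists>i. a \<le> real i / 2 ^ Suc n \<and> real i / 2 ^ Suc n \<le> u \<and> X (real i / 2 ^ Suc n) \<omega> \<in> U)"
      by metis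
    then show ?thesis unfolding H_def by auto
  qed
  have "occupation {a..b} (\<lambda>z. indicator U (z - x) * g z) x =
        (\<integral>\<^sup>+\<omega>. (\<integral>\<^sup>+u\<in>{a..b}. (indicator U (X u \<omega>) * g (x + X u \<omega>)) \<partial>lborel) \<partial>M)"
    by (subst occupation_path) simp_all
  also have "\<dots> \<le> (\<integral>\<^sup>+\<omega>. (\<integral>\<^sup>+u. (SUP n. H n u \<omega> * (g (x + X u \<omega>) * indicator {a..b} u)) \<partial>lborel) \<partial>M)"
  proof (rule nn_integral_mono, rule nn_integral_mono_AE)
    fix \<omega> assume "\<omega> \<in> space M"
    show "AE u in lborel. indicator U (X u \<omega>) * g (x + X u \<omega>) * indicator {a..b} u \<le>
            (SUP n. H n u \<omega> * (g (x + X u \<omega>) * indicator {a..b} u))"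
      using AE_dyadic_hit_before[OF a U, of \<omega>]
    proof eventually_elim
      case (elim u)
      show ?case
      proof (cases "X u \<omega> \<in> U \<and> u \<in> {a..b}")
        case True
        with elim obtain n where "H n u \<omega> = 1"
          unfolding H_def by auto
        then show ?thesis
          using True by (intro SUP_upper2[of n]) auto
      qed auto
    qed
  qed
  also have "\<dots> = (\<integral>\<^sup>+u. (\<integral>\<^sup>+\<omega>. (SUP n. H n u \<omega> * (g (x + X u \<omega>) * indicator {a..b} u)) \<partial>M) \<partial>lborel)"
    by (rule Fubini_time) measurable
  also have "\<dots> = (\<integral>\<^sup>+u. (SUP n. \<integral>\<^sup>+\<omega>. H n u \<omega> * (g (x + X u \<omega>) * indicator {a..b} u) \<partial>M) \<partial>lborel)"
    by (intro nn_integral_cong nn_integral_monotone_convergence_SUP incseq_SucI le_funI mult_right_mono inc)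
       auto
  also have "\<dots> = (SUP n. \<integral>\<^sup>+u. (\<integral>\<^sup>+\<omega>. H n u \<omega> * (g (x + X u \<omega>) * indicator {a..b} u) \<partial>M) \<partial>lborel)"
    by (intro nn_integral_monotone_convergence_SUP incseq_SucI le_funI nn_integral_mono mult_right_mono inc)
       auto
  also have "\<dots> = (SUP n. \<integral>\<^sup>+u\<in>{a..b}. (\<integral>\<^sup>+\<omega>. H n u \<omega> * g (x + X u \<omega>) \<partial>M) \<partial>lborel)"
    by (intro SUP_cong nn_integral_cong refl) (auto split: split_indicator)
  also have "\<dots> \<le> emeasure M (hits {a..b} U) * B"
    unfolding H_def by (intro SUP_least grid_hitting_bound B) auto
  finally show ?thesis .
qed

end

section \<open>Probabilities of visits\<close>

lemma (in finite_measure) decseq_emeasure_less: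
  assumes [measurable]: "\<And>n. A n \<in> sets M" and "decseq A" "AE \<omega> in M. \<exists>n. \<omega> \<notin> A n" "0 < \<epsilon>"
  obtains n where "emeasure M (A n) < \<epsilon>"
proof -
  have "(\<lambda>n. emeasure M (A n)) \<longlonglongrightarrow> emeasure M (\<Inter>n. A n)"
    using assms by (intro Lim_emeasure_decseq) auto
  moreover have "emeasure M (\<Inter>n. A n) = 0"
    using assms(3) AE_iff_null_sets[of "\<Inter>n. A n" M] by (auto simp: null_sets_def)
  ultimately have "\<forall>\<^sub>F n in sequentially. emeasure M (A n) < \<epsilon>"
    using assms(4) by (auto dest: order_tendstoD)
  then show thesis
    using that by (auto simp: eventually_sequentially)
qed

context regular_levy_process
begin

text \<open>Paths start at 0 and are right-continuous, so each stays within \<open>r\<close> on some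
  interval \<open>{0..1 / real (Suc n)}\<close>; the exit events decrease in
  \<open>n\<close>.\<close>

lemma exit_probability_small:
  assumes r: "0 < r" and \<epsilon>: "0 < \<epsilon>"
  obtains t where "0 < t" "emeasure M (hits {0..t} {z. r < norm z}) < \<epsilon>"
proof -
  have "AE \<omega> in M. \<exists>n. \<omega> \<notin> hits {0..1 / real (Suc n)} {z. r < norm z}"
  proof (rule AE_I2)
    fix \<omega>
    have "((\<lambda>s. norm (X s \<omega>)) \<longlongrightarrow> 0) (at_right 0)"
      using tendsto_norm[OF right_continuous[of \<omega> 0]] by (simp add: X_nonpos)
    then have "\<forall>\<^sub>F s in at_right 0. norm (X s \<omega>) < r"
      using r by (rule order_tendstoD)
    then obtain c where c: "c > 0" "\<And>s. 0 < s \<Longrightarrow> s < c \<Longrightarrow> norm (X s \<omega>) < r"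
      unfolding eventually_at_right_field by blast
    obtain n where n: "1 / real (Suc n) < c"
      using nat_approx_posE[OF c(1)] by metis
    have "\<not> r < norm (X s \<omega>)" if "s \<in> {0..1 / real (Suc n)}" for s
    proof (cases "s = 0")
      case False
      then have "0 < s" "s < c" using that n by auto
      then show ?thesis using c(2)[of s] by linarith
    qed (use r in \<open>simp add: X_nonpos\<close>)
    then show "\<exists>n. \<omega> \<notin> hits {0..1 / real (Suc n)} {z. r < norm z}"
      unfolding hits_def by blast
  qed
  moreover have "decseq (\<lambda>n. hits {0..1 / real (Suc n)} {z. r < norm z})"
  proof (intro decseq_SucI hits_mono order_refl)
    fix n :: nat
    have "1 / real (Suc (Suc n)) \<le> 1 / real (Suc n)" by (simp add: frac_le)
    then show "{0..1 / real (Suc (Suc n))} \<subseteq> {0..1 / real (Suc n)}"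
      by (intro atLeastatMost_subset_iff[THEN iffD2]) simp
  qed
  ultimately obtain n where "emeasure M (hits {0..1 / real (Suc n)} {z. r < norm z}) < \<epsilon>"
    by (elim decseq_emeasure_less[OF _ _ _ \<epsilon>, rotated]) simp_all
  then show thesis by (intro that[of "1 / real (Suc n)"]) auto
qed

text \<open>By transience almost every path is outside the ball from some time on, so the events of
  a visit after time \<open>real (Suc n)\<close> decrease to a null event.\<close>

lemma transient_hits_small:
  assumes tr: "transient M X" and \<epsilon>: "0 < \<epsilon>"
  obtains T where "0 < T" "emeasure M (hits {T..} (ball 0 r)) < \<epsilon>"
proof -
  have "AE \<omega> in M. \<exists>n. \<omega> \<notin> hits {real (Suc n)..} (ball 0 r)"
    using tr[unfolded transient_def]
  proof eventually_elim
    case (elim \<omega>)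
    then have "\<forall>\<^sub>F s in at_top. r \<le> norm (X s \<omega>)"
      by (simp add: filterlim_at_top)
    then obtain c where c: "\<And>s. c \<le> s \<Longrightarrow> r \<le> norm (X s \<omega>)"
      by (auto simp: eventually_at_top_linorder)
    obtain n where n: "c < real n" using reals_Archimedean2 by blast
    have "r \<le> norm (X s \<omega>)" if "real (Suc n) \<le> s" for s
      using that n by (intro c) simp
    then show ?case
      by (intro exI[of _ n]) (auto simp: hits_def not_less)
  qed
  moreover have "decseq (\<lambda>n. hits {real (Suc n)..} (ball 0 r))"
    by (intro decseq_SucI hits_mono order_refl) auto
  ultimately obtain n where "emeasure M (hits {real (Suc n)..} (ball 0 r)) < \<epsilon>"
    by (elim decseq_emeasure_less[OF _ _ _ \<epsilon>, rotated]) simp_all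
  then show thesis by (intro that[of "real (Suc n)"]) auto
qed

text \<open>
  If the path visits all balls \<open>B(0, 1/j)\<close> during \<open>[t, T)\<close>, let \<open>\<rho>\<close> be the limit of its entrance times.
  A small time \<open>s\<close> after entering \<open>B(0, 1/j)\<close> it is still close to 0 on average, while
  right-continuity at \<open>\<rho>\<close> identifies the iterated limit over \<open>j\<close> and \<open>s\<close> of these positions with \<open>X\<^sub>\<rho>\<close>.
  Hence \<open>X\<^sub>\<rho> = 0\<close>, although \<open>\<rho>\<close> is only known to be a time at which the left limit may vanish.
\<close>

lemma AE_avoids_zero:
  assumes polar: "AE \<omega> in M. \<forall>u>0. X u \<omega> \<noteq> 0" and t: "0 < t"
  shows "AE \<omega> in M. \<exists>j. \<omega> \<notin> hits {t..<T} (ball 0 (1 / real (Suc j)))"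
proof -
  define s where "s m = 1 / real (Suc m)" for m :: nat
  have s_pos: "0 < s m" for m by (simp add: s_def)
  have s_lim: "s \<longlonglongrightarrow> 0"
    using LIMSEQ_inverse_real_of_nat by (simp add: s_def[abs_def] inverse_eq_divide)
  \<comment> \<open>Truncation at 1 makes dominated convergence available and keeps the triangle
    inequality.\<close>
  define \<phi> :: "'a \<Rightarrow> ennreal" where "\<phi> z = ennreal (min 1 (norm z))" for z
  have \<phi> [measurable]: "\<phi> \<in> borel_measurable borel"
    unfolding \<phi>_def by measurable
  define A where "A j = first_hit {t..<T} (ball 0 (s j))" for j
  have [measurable]: "A j n i \<in> sets M" for j n i
    unfolding A_def by measurable
  \<comment> \<open>At most one summand is nonzero: the truncated distance from 0 at delay
    \<open>s m\<close> after the first visit to \<open>ball 0 (s j)\<close> on the mesh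
    \<open>2^-n\<close>.\<close>
  define Z where "Z m j n \<omega> = (\<Sum>i. indicator (A j n i) \<omega> * \<phi> (X (real i / 2 ^ n + s m) \<omega>))" for m j n \<omega>
  have [measurable]: "Z m j n \<in> borel_measurable M" for m j n
    unfolding Z_def by measurable
  define c where "c m = (\<integral>\<^sup>+\<omega>. \<phi> (X (s m) \<omega>) \<partial>M)" for m
  \<comment> \<open>Markov property at the first visit, where the norm is below \<open>s j\<close>,
    and the triangle inequality; the first-visit probabilities sum to at most 1.\<close>
  have Z_le: "(\<integral>\<^sup>+\<omega>. Z m j n \<omega> \<partial>M) \<le> ennreal (s j) + c m" for m j n
  proof -
    have "(\<integral>\<^sup>+\<omega>. Z m j n \<omega> \<partial>M) = (\<Sum>i. \<integral>\<^sup>+\<omega>. indicator (A j n i) \<omega> * \<phi> (X (real i / 2 ^ n + s m) \<omega>) \<partial>M)"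
      unfolding Z_def by (intro nn_integral_suminf) measurable
    also have "\<dots> \<le> (\<Sum>i. emeasure M (A j n i) * (ennreal (s j) + c m))"
    proof (intro suminf_le allI)
      fix i
      have "(\<integral>\<^sup>+\<omega>. indicator (A j n i) \<omega> * \<phi> (X (real i / 2 ^ n + s m) \<omega>) \<partial>M) =
            (\<integral>\<^sup>+\<omega>. indicator (A j n i) \<omega> * (\<integral>\<^sup>+\<omega>'. \<phi> (X (real i / 2 ^ n) \<omega> + X (s m) \<omega>') \<partial>M) \<partial>M)"
        using markov_first_hit[of "ball 0 (s j)" "\<lambda>p. \<phi> (fst p + snd p)" "s m" "{t..<T}" n i] s_pos[of m]
        by (simp add: A_def)
      also have "\<dots> \<le> (\<integral>\<^sup>+\<omega>. (ennreal (s j) + c m) * indicator (A j n i) \<omega> \<partial>M)"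
      proof (rule nn_integral_mono)
        fix \<omega>
        show "indicator (A j n i) \<omega> * (\<integral>\<^sup>+\<omega>'. \<phi> (X (real i / 2 ^ n) \<omega> + X (s m) \<omega>') \<partial>M) \<le>
              (ennreal (s j) + c m) * indicator (A j n i) \<omega>"
        proof (cases "\<omega> \<in> A j n i")
          case True
          then have nrm: "norm (X (real i / 2 ^ n) \<omega>) < s j"
            by (simp add: A_def first_hit_def)
          have "\<phi> (X (real i / 2 ^ n) \<omega> + z) \<le> ennreal (s j) + \<phi> z" for z
          proof -
            have "norm (X (real i / 2 ^ n) \<omega> + z) \<le> s j + norm z"
              using nrm norm_triangle_ineq[of "X (real i / 2 ^ n) \<omega>" z] by linarith
            then have "min 1 (norm (X (real i / 2 ^ n) \<omega> + z)) \<le> s j + min 1 (norm z)"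
              using s_pos[of j] by linarith
            then show ?thesis
              unfolding \<phi>_def using s_pos[of j] by (simp flip: ennreal_plus add: ennreal_leI)
          qed
          then have "(\<integral>\<^sup>+\<omega>'. \<phi> (X (real i / 2 ^ n) \<omega> + X (s m) \<omega>') \<partial>M) \<le>
                (\<integral>\<^sup>+\<omega>'. ennreal (s j) + \<phi> (X (s m) \<omega>') \<partial>M)"
            by (intro nn_integral_mono) auto
          also have "\<dots> = ennreal (s j) + c m"
            unfolding c_def by (subst nn_integral_add) (simp_all add: emeasure_space_1)
          finally show ?thesis using True by simp
        qed simp
      qed
      also have "\<dots> = emeasure M (A j n i) * (ennreal (s j) + c m)"
        by (simp add: nn_integral_cmult mult.commute)
      finally show "(\<integral>\<^sup>+\<omega>. indicator (A j n i) \<omega> * \<phi> (X (real i / 2 ^ n + s m) \<omega>) \<partial>M) \<le>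
         emeasure M (A j n i) * (ennreal (s j) + c m)" .
    qed auto
    also have "\<dots> = (\<Sum>i. emeasure M (A j n i)) * (ennreal (s j) + c m)"
      by (rule ennreal_suminf_multc)
    also have "\<dots> \<le> 1 * (ennreal (s j) + c m)"
      unfolding A_def
      by (intro mult_right_mono order_trans[OF sum_emeasure_first_hit_le] emeasure_le_1) auto
    finally show ?thesis by simp
  qed
  have c_lim: "c \<longlonglongrightarrow> 0"
  proof -
    have "(\<lambda>m. \<integral>\<^sup>+\<omega>. \<phi> (X (s m) \<omega>) \<partial>M) \<longlonglongrightarrow> (\<integral>\<^sup>+\<omega>. 0 \<partial>M)"
    proof (rule nn_integral_dominated_convergence[where w = "\<lambda>_. 1"])
      have "(\<lambda>m. X (s m) \<omega>) \<longlonglongrightarrow> 0" for \<omega>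
        using filterlim_compose[OF right_continuous[of \<omega> 0], of s sequentially] s_lim s_pos
        by (simp add: filterlim_at X_nonpos less_imp_neq[OF s_pos, THEN not_sym])
      then have "(\<lambda>m. min 1 (norm (X (s m) \<omega>))) \<longlonglongrightarrow> min 1 (norm (0::'a))" for \<omega>
        by (intro tendsto_intros)
      then have "(\<lambda>m. \<phi> (X (s m) \<omega>)) \<longlonglongrightarrow> ennreal (min 1 (norm (0::'a)))" for \<omega>
        unfolding \<phi>_def by (intro tendsto_ennrealI)
      then show "AE \<omega> in M. (\<lambda>m. \<phi> (X (s m) \<omega>)) \<longlonglongrightarrow> 0" by simp
    qed (auto simp: \<phi>_def emeasure_space_1 ennreal_le_1)
    then show ?thesis by (simp add: c_def[abs_def])
  qed
  \<comment> \<open>The order of the limits matters: first the mesh, so that grid visits come near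
    the entrance time \<open>\<sigma> j\<close> defined below; then the radius, so that
    \<open>\<sigma> j\<close> approaches its limit \<open>\<rho>\<close>; the delay last. Fatou's
    lemma in each limit bounds the mean of \<open>L\<close> by \<open>liminf c\<close>, which is
    0.\<close>
  define L where "L \<omega> = liminf (\<lambda>m. liminf (\<lambda>j. liminf (\<lambda>n. Z m j n \<omega>)))" for \<omega>
  have [measurable]: "L \<in> borel_measurable M"
    unfolding L_def by measurable
  have "(\<integral>\<^sup>+\<omega>. L \<omega> \<partial>M) \<le> liminf (\<lambda>m. \<integral>\<^sup>+\<omega>. liminf (\<lambda>j. liminf (\<lambda>n. Z m j n \<omega>)) \<partial>M)"
    unfolding L_def by (intro nn_integral_liminf) measurable
  also have "\<dots> \<le> liminf (\<lambda>m. liminf (\<lambda>j. \<integral>\<^sup>+\<omega>. liminf (\<lambda>n. Z m j n \<omega>) \<partial>M))"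
    by (intro Liminf_mono always_eventually allI nn_integral_liminf) measurable
  also have "\<dots> \<le> liminf (\<lambda>m. liminf (\<lambda>j. liminf (\<lambda>n. \<integral>\<^sup>+\<omega>. Z m j n \<omega> \<partial>M)))"
    by (intro Liminf_mono always_eventually allI nn_integral_liminf) measurable
  also have "\<dots> \<le> liminf (\<lambda>m. liminf (\<lambda>j. liminf (\<lambda>n::nat. ennreal (s j) + c m)))"
    by (intro Liminf_mono always_eventually allI Z_le)
  also have "\<dots> = liminf c"
  proof -
    have "(\<lambda>j. ennreal (s j) + c m) \<longlonglongrightarrow> ennreal 0 + c m" for m
      by (intro tendsto_add tendsto_const tendsto_ennrealI s_lim)
    then have "liminf (\<lambda>j. ennreal (s j) + c m) = c m" for m
      by (intro lim_imp_Liminf) auto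
    then show ?thesis by (simp add: Liminf_const)
  qed
  also have "\<dots> = 0"
    using c_lim by (intro lim_imp_Liminf) auto
  finally have "AE \<omega> in M. L \<omega> = 0"
    by (subst (asm) le_zero_eq, subst (asm) nn_integral_0_iff_AE) auto
  then show ?thesis
    using polar AE_space
  proof eventually_elim
    case (elim \<omega>)
    show ?case
    proof (rule ccontr)
      assume "\<nexists>j. \<omega> \<notin> hits {t..<T} (ball 0 (1 / real (Suc j)))"
      then have hit: "\<omega> \<in> hits {t..<T} (ball 0 (s j))" for j
        by (simp add: s_def)
      \<comment> \<open>The infimum \<open>\<sigma> j\<close> need not itself be a visit time. Since
        the balls shrink it is nondecreasing in \<open>j\<close>, with limit \<open>\<rho>\<close>
        at most \<open>T\<close>.\<close>
      define S where "S j = {v. \<exists>n i. v = real i / 2 ^ n \<and> v \<in> {t..<T} \<and> norm (X v \<omega>) < s j}" for j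
      define \<sigma> where "\<sigma> j = Inf (S j)" for j
      have ne: "S j \<noteq> {}" for j
        using hit[of j] by (auto simp: hits_def S_def)
      have bdd: "bdd_below (S j)" for j
        by (rule bdd_belowI[of _ t]) (auto simp: S_def)
      have \<sigma>_ge: "t \<le> \<sigma> j" for j
        unfolding \<sigma>_def by (rule cInf_greatest[OF ne]) (auto simp: S_def)
      have \<sigma>_le: "\<sigma> j \<le> v" if "v \<in> S j" for j v
        unfolding \<sigma>_def using that bdd by (rule cInf_lower)
      have \<sigma>_T: "\<sigma> j \<le> T" for j
        using ne[of j] \<sigma>_le[of _ j] by (force simp: S_def)
      have \<sigma>_mono: "\<sigma> i \<le> \<sigma> j" if "i \<le> j" for i j
      proof -
        have "s j \<le> s i" using that by (simp add: s_def frac_le)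
        then have "S j \<subseteq> S i" unfolding S_def by force
        then show ?thesis unfolding \<sigma>_def by (intro cInf_superset_mono ne bdd)
      qed
      define \<rho> where "\<rho> = (SUP j. \<sigma> j)"
      have bdd': "bdd_above (range \<sigma>)"
        by (rule bdd_aboveI[of _ T]) (auto simp: \<sigma>_T)
      have \<sigma>_\<rho>: "\<sigma> j \<le> \<rho>" for j
        unfolding \<rho>_def by (intro cSUP_upper bdd') auto
      \<comment> \<open>Positivity of \<open>t\<close> enters here: polarity applies at
        \<open>\<rho>\<close>.\<close>
      have "0 < \<rho>" using t \<sigma>_ge[of 0] \<sigma>_\<rho>[of 0] by linarith
      then have "0 < norm (X \<rho> \<omega>)" using elim by simp
      define \<kappa> where "\<kappa> = norm (X \<rho> \<omega>) / 2"
      have \<kappa>: "0 < \<kappa>" using \<open>0 < norm (X \<rho> \<omega>)\<close> by (simp add: \<kappa>_def)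
      have "\<forall>\<^sub>F u in at_right \<rho>. \<kappa> < norm (X u \<omega>)"
        using tendsto_norm[OF right_continuous[of \<omega> \<rho>]] \<kappa> by (intro order_tendstoD) (auto simp: \<kappa>_def)
      then obtain b where b: "b > \<rho>" "\<And>u. \<rho> < u \<Longrightarrow> u < b \<Longrightarrow> \<kappa> < norm (X u \<omega>)"
        unfolding eventually_at_right_field by blast
      define \<eta> where "\<eta> = (b - \<rho>) / 2"
      have \<eta>: "0 < \<eta>" using b by (simp add: \<eta>_def)
      \<comment> \<open>The sampled time \<open>i / 2^n + s m\<close> lies between
        \<open>\<rho>\<close> and \<open>b\<close>. It exceeds \<open>\<rho>\<close> because the
        grid visit is not before \<open>\<sigma> j > \<rho> - s m\<close>; it is below
        \<open>b = \<rho> + 2 * \<eta>\<close> because the visit is before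
        \<open>\<sigma> j + \<eta>\<close> and the delay is below \<open>\<eta>\<close>.\<close>
      have Z_ge: "ennreal (min 1 \<kappa>) \<le> Z m j n \<omega>"
        if m: "s m < \<eta>" and j: "\<rho> - s m < \<sigma> j"
          and v: "real k / 2 ^ N \<in> S j" "real k / 2 ^ N < \<sigma> j + \<eta>" and n: "N \<le> n" for m j n k N
      proof -
        \<comment> \<open>The dyadic time \<open>k / 2^N\<close> written on the finer mesh
          \<open>2^-n\<close>.\<close>
        define k' where "k' = k * 2 ^ (n - N)"
        have k': "real k' / 2 ^ n = real k / 2 ^ N"
          using n by (simp add: k'_def field_simps flip: power_add)
        obtain i where i: "i \<le> k'" "\<omega> \<in> A j n i"
          using ex_first_hit[of \<omega> k' n "{t..<T}" "ball 0 (s j)"] v(1) elim unfolding k' A_def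
          by (auto simp: S_def)
        have "real i / 2 ^ n \<in> S j"
          using i(2) unfolding A_def first_hit_def S_def by auto
        then have "\<sigma> j \<le> real i / 2 ^ n" by (rule \<sigma>_le)
        with j have "\<rho> < real i / 2 ^ n + s m" by linarith
        moreover have "real i / 2 ^ n + s m < b"
        proof -
          have "real i / 2 ^ n \<le> real k / 2 ^ N"
            unfolding k'[symmetric] using i(1) by (simp add: divide_right_mono)
          then have "real i / 2 ^ n + s m < (\<sigma> j + \<eta>) + \<eta>"
            by (intro add_strict_mono m le_less_trans[OF _ v(2)])
          also have "\<dots> \<le> \<rho> + \<eta> + \<eta>"
            using \<sigma>_\<rho>[of j] by simp
          also have "\<dots> = b" by (simp add: \<eta>_def)
          finally show ?thesis .
        qed
        ultimately have "\<kappa> < norm (X (real i / 2 ^ n + s m) \<omega>)" by (rule b(2))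
        then have "ennreal (min 1 \<kappa>) \<le> indicator (A j n i) \<omega> * \<phi> (X (real i / 2 ^ n + s m) \<omega>)"
          unfolding \<phi>_def using i(2) by (auto intro!: ennreal_leI)
        also have "\<dots> \<le> Z m j n \<omega>"
          unfolding Z_def by (rule ennreal_le_suminf)
        finally show ?thesis .
      qed
      have "\<forall>\<^sub>F m in sequentially. s m < \<eta>"
        using s_lim \<eta> by (rule order_tendstoD)
      then have "ennreal (min 1 \<kappa>) \<le> L \<omega>"
        unfolding L_def
      proof (intro Liminf_bounded, eventually_elim)
        case (elim m)
        have "\<exists>j0. \<rho> - s m < \<sigma> j0"
          unfolding \<rho>_def using s_pos[of m] bdd' less_cSUP_iff[of UNIV \<sigma> "\<rho> - s m"] by (auto simp: \<rho>_def)
        then obtain j0 where "\<rho> - s m < \<sigma> j0" by blast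
        then have "\<forall>\<^sub>F j in sequentially. \<rho> - s m < \<sigma> j"
          using \<sigma>_mono by (force simp: eventually_sequentially intro: less_le_trans)
        then show "ennreal (min 1 \<kappa>) \<le> liminf (\<lambda>j. liminf (\<lambda>n. Z m j n \<omega>))"
        proof (intro Liminf_bounded, eventually_elim)
          case (elim j)
          obtain v where v: "v \<in> S j" "v < \<sigma> j + \<eta>"
            using cInf_lessD[OF ne[of j], of "\<sigma> j + \<eta>"] \<eta> by (auto simp: \<sigma>_def)
          then obtain N k where "v = real k / 2 ^ N" by (auto simp: S_def)
          with v have "\<forall>\<^sub>F n in sequentially. ennreal (min 1 \<kappa>) \<le> Z m j n \<omega>"
            using Z_ge[OF \<open>s m < \<eta>\<close> \<open>\<rho> - s m < \<sigma> j\<close>] by (auto simp: eventually_sequentially)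
          then show ?case by (rule Liminf_bounded)
        qed
      qed
      then show False using elim(1) \<kappa> by simp
    qed
  qed
qed

text \<open>Almost every path is outside the unit ball from some time on, so its visits to balls of
  radius at most 1 occur before some integer \<open>N\<close>, where \<open>AE_avoids_zero\<close>
  applies; the events decrease with the radius.\<close>

lemma polar_hits_small:
  assumes tr: "transient M X" and polar: "AE \<omega> in M. \<forall>u>0. X u \<omega> \<noteq> 0"
    and t: "0 < t" and \<epsilon>: "0 < \<epsilon>"
  obtains r where "0 < r" "r \<le> 1" "emeasure M (hits {t..} (ball 0 r)) < \<epsilon>"
proof -
  have "AE \<omega> in M. \<forall>N::nat. \<exists>j. \<omega> \<notin> hits {t..<real N} (ball 0 (1 / real (Suc j)))"
    using AE_avoids_zero[OF polar t] by (simp add: AE_all_countable)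
  then have "AE \<omega> in M. \<exists>j. \<omega> \<notin> hits {t..} (ball 0 (1 / real (Suc j)))"
    using tr[unfolded transient_def]
  proof eventually_elim
    case (elim \<omega>)
    then have "\<forall>\<^sub>F s in at_top. 1 \<le> norm (X s \<omega>)"
      by (simp add: filterlim_at_top)
    then obtain c where c: "\<And>s. c \<le> s \<Longrightarrow> 1 \<le> norm (X s \<omega>)"
      by (auto simp: eventually_at_top_linorder)
    obtain N where N: "c < real N" using reals_Archimedean2 by blast
    obtain j where j: "\<omega> \<notin> hits {t..<real N} (ball 0 (1 / real (Suc j)))"
      using elim by blast
    have "\<omega> \<notin> hits {t..} (ball 0 (1 / real (Suc j)))"
    proof
      assume "\<omega> \<in> hits {t..} (ball 0 (1 / real (Suc j)))"
      then obtain n i where v: "\<omega> \<in> space M" "t \<le> real i / 2 ^ n" "norm (X (real i / 2 ^ n) \<omega>) < 1 / real (Suc j)"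
        by (auto simp: hits_def)
      have "1 / real (Suc j) \<le> 1" by simp
      with v have "\<not> 1 \<le> norm (X (real i / 2 ^ n) \<omega>)" by linarith
      then have "\<not> c \<le> real i / 2 ^ n" using c by blast
      then have "\<omega> \<in> hits {t..<real N} (ball 0 (1 / real (Suc j)))"
        using v N unfolding hits_def by fastforce
      with j show False ..
    qed
    then show ?case ..
  qed
  moreover have "decseq (\<lambda>j. hits {t..} (ball 0 (1 / real (Suc j))))"
    by (intro decseq_SucI hits_mono order_refl subset_ball) (simp add: field_simps)
  ultimately obtain j where "emeasure M (hits {t..} (ball 0 (1 / real (Suc j)))) < \<epsilon>"
    by (elim decseq_emeasure_less[OF _ _ _ \<epsilon>, rotated]) simp_all
  then show thesis by (intro that[of "1 / real (Suc j)"]) auto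
qed

end

section \<open>Comparison of the Kato conditions\<close>

text \<open>The weak inequality on the right suits suprema, whose bounds come from
  \<open>SUP_least\<close>.\<close>

lemma tendsto_zero_at_right_iff:
  fixes F :: "real \<Rightarrow> ennreal"
  shows "(F \<longlongrightarrow> 0) (at_right 0) \<longleftrightarrow> (\<forall>\<epsilon>>0. \<exists>b>0. \<forall>y. 0 < y \<and> y < b \<longrightarrow> F y \<le> ennreal \<epsilon>)"
proof
  assume F: "(F \<longlongrightarrow> 0) (at_right 0)"
  show "\<forall>\<epsilon>>0. \<exists>b>0. \<forall>y. 0 < y \<and> y < b \<longrightarrow> F y \<le> ennreal \<epsilon>"
  proof (intro allI impI)
    fix \<epsilon> :: real assume "0 < \<epsilon>"
    then have "\<forall>\<^sub>F y in at_right 0. F y < ennreal \<epsilon>"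
      by (intro order_tendstoD(2)[OF F]) simp
    then show "\<exists>b>0. \<forall>y. 0 < y \<and> y < b \<longrightarrow> F y \<le> ennreal \<epsilon>"
      unfolding eventually_at_right_field by (auto intro: less_imp_le)
  qed
next
  assume R: "\<forall>\<epsilon>>0. \<exists>b>0. \<forall>y. 0 < y \<and> y < b \<longrightarrow> F y \<le> ennreal \<epsilon>"
  show "(F \<longlongrightarrow> 0) (at_right 0)"
  proof (rule order_tendstoI)
    fix a :: ennreal assume "0 < a"
    then obtain y where y: "0 < y" "y < a" using dense by blast
    then obtain e where e: "0 < e" "ennreal e < a"
      by (cases y) (auto simp: order.strict_trans)
    then obtain b where "b > 0" "\<And>y. 0 < y \<Longrightarrow> y < b \<Longrightarrow> F y \<le> ennreal e"
      using R by blast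
    then show "\<forall>\<^sub>F y in at_right 0. F y < a"
      unfolding eventually_at_right_field using e(2) by (auto intro!: exI[of _ b] intro: le_less_trans)
  qed simp
qed

text \<open>Absorption of half of \<open>a\<close> on the left. Finiteness is essential, since
  \<open>a = \<infinity>\<close> satisfies the first inequality for every \<open>b\<close>.\<close>

lemma ennreal_le_double:
  fixes a b :: ennreal
  assumes "a \<le> b + ennreal (1/2) * a" "a < \<infinity>"
  shows "a \<le> 2 * b"
proof (cases "b = \<infinity>")
  case False
  with assms obtain a' b' where [simp]: "a = ennreal a'" "0 \<le> a'" "b = ennreal b'" "0 \<le> b'"
    by (cases a; cases b) auto
  have "ennreal b' + ennreal (1/2) * ennreal a' = ennreal (b' + 1/2 * a')"
    by (subst ennreal_mult[symmetric]) (simp_all del: ennreal_half)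
  then have "ennreal a' \<le> ennreal (b' + 1/2 * a')"
    using assms(1) by simp
  then have "a' \<le> 2 * b'"
    by (subst (asm) ennreal_le_iff) (simp_all add: field_simps)
  then have "ennreal a' \<le> ennreal (2 * b')" by (rule ennreal_leI)
  then show ?thesis by (simp add: ennreal_mult)
qed (simp add: ennreal_mult_top)

lemma sets_borel_ball [measurable]: "ball x r \<in> sets borel"
  by simp

lemma half_pos: "0 < ennreal (1/2)"
  by (subst ennreal_less_zero_iff) simp

context regular_levy_process
begin

section \<open>Rules for occupation integrals\<close>

lemma occupation_mono:
  assumes "\<And>z. f z \<le> g z" "I \<subseteq> J"
  shows "occupation I f x \<le> occupation J g x"
  unfolding occupation_def
  by (intro nn_integral_mono mult_mono assms) (use assms(2) in \<open>auto split: split_indicator\<close>)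

lemma occupation_cong: "(\<And>\<omega> u. f (x + X u \<omega>) = g (x + X u \<omega>)) \<Longrightarrow> occupation I f x = occupation I g x"
  unfolding occupation_def by simp

lemma occupation_Un_le:
  assumes [measurable]: "f \<in> borel_measurable borel" "A \<in> sets borel" "B \<in> sets borel" and "I \<subseteq> A \<union> B"
  shows "occupation I f x \<le> occupation A f x + occupation B f x"
  unfolding occupation_def
  by (subst nn_integral_add[symmetric])
     (use assms(4) in \<open>auto intro!: nn_integral_mono split: split_indicator\<close>)

lemma occupation_add:
  assumes [measurable]: "f \<in> borel_measurable borel" "g \<in> borel_measurable borel" "I \<in> sets borel"
  shows "occupation I (\<lambda>z. f z + g z) x = occupation I f x + occupation I g x"
proof -
  have "(\<integral>\<^sup>+\<omega>. f (x + X u \<omega>) + g (x + X u \<omega>) \<partial>M) =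
        (\<integral>\<^sup>+\<omega>. f (x + X u \<omega>) \<partial>M) + (\<integral>\<^sup>+\<omega>. g (x + X u \<omega>) \<partial>M)" for u
    by (rule nn_integral_add) measurable
  then show ?thesis
    unfolding occupation_def by (simp add: distrib_right nn_integral_add)
qed

lemma occupation_atLeast_le:
  assumes [measurable]: "f \<in> borel_measurable borel" and B: "\<And>n::nat. occupation {0..real n} f x \<le> B"
  shows "occupation {0..} f x \<le> B"
proof -
  have "occupation {0..} f x = (\<integral>\<^sup>+u. (SUP n. (\<integral>\<^sup>+\<omega>. f (x + X u \<omega>) \<partial>M) * indicator {0..real n} u) \<partial>lborel)"
    unfolding occupation_def
  proof (rule nn_integral_cong)
    fix u :: real
    have ind: "indicator {0..} u = (SUP n. indicator {0..real n} u :: ennreal)"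
    proof (cases "0 \<le> u")
      case True
      obtain n where "u \<le> real n" using real_arch_simple by blast
      then have "(1::ennreal) \<le> (SUP n. indicator {0..real n} u)"
        using True by (intro SUP_upper2[of n]) auto
      moreover have "(SUP n. indicator {0..real n} u :: ennreal) \<le> 1"
        by (intro SUP_least) (simp split: split_indicator)
      ultimately show ?thesis using True by simp
    qed simp
    show "(\<integral>\<^sup>+\<omega>. f (x + X u \<omega>) \<partial>M) * indicator {0..} u =
            (SUP n. (\<integral>\<^sup>+\<omega>. f (x + X u \<omega>) \<partial>M) * indicator {0..real n} u)"
      unfolding ind by (rule SUP_mult_left_ennreal)
  qed
  also have "\<dots> = (SUP n. occupation {0..real n} f x)"
    unfolding occupation_def
    by (intro nn_integral_monotone_convergence_SUP incseq_SucI le_funI mult_left_mono) (auto split: split_indicator)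
  also have "\<dots> \<le> B"
    by (intro SUP_least B)
  finally show ?thesis .
qed

text \<open>Monotone convergence in the truncation level \<open>n\<close>. Bounded functions have
  finite occupation over bounded time intervals, as absorption requires.\<close>

lemma occupation_truncate_le:
  assumes [measurable]: "f \<in> borel_measurable borel" "I \<in> sets borel"
    and B: "\<And>n::nat. occupation I (\<lambda>z. min (f z) (of_nat n)) x \<le> B"
  shows "occupation I f x \<le> B"
proof -
  have "f z = (SUP n. min (f z) (of_nat n))" for z
  proof -
    have "(SUP n. inf (f z) (of_nat n)) = inf (f z) (SUP n. of_nat n)"
      by (simp add: inf_SUP)
    then show ?thesis by (simp add: ennreal_SUP_of_nat_eq_top inf_min)
  qed
  then have "occupation I f x = (\<integral>\<^sup>+\<omega>. (\<integral>\<^sup>+u. (SUP n. min (f (x + X u \<omega>)) (of_nat n)) * indicator I u \<partial>lborel) \<partial>M)"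
    by (subst occupation_path) simp_all
  also have "\<dots> = (\<integral>\<^sup>+\<omega>. (\<integral>\<^sup>+u. (SUP n. min (f (x + X u \<omega>)) (of_nat n) * indicator I u) \<partial>lborel) \<partial>M)"
    by (simp only: SUP_mult_right_ennreal)
  also have "\<dots> = (\<integral>\<^sup>+\<omega>. (SUP n. \<integral>\<^sup>+u. min (f (x + X u \<omega>)) (of_nat n) * indicator I u \<partial>lborel) \<partial>M)"
    by (intro nn_integral_cong nn_integral_monotone_convergence_SUP incseq_SucI le_funI mult_right_mono min.mono)
       auto
  also have "\<dots> = (SUP n. \<integral>\<^sup>+\<omega>. (\<integral>\<^sup>+u. min (f (x + X u \<omega>)) (of_nat n) * indicator I u \<partial>lborel) \<partial>M)"
    by (intro nn_integral_monotone_convergence_SUP incseq_SucI le_funI nn_integral_mono mult_right_mono min.mono)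
       auto
  also have "\<dots> = (SUP n. occupation I (\<lambda>z. min (f z) (of_nat n)) x)"
    by (subst occupation_path) simp_all
  also have "\<dots> \<le> B"
    by (intro SUP_least B)
  finally show ?thesis .
qed

text \<open>If \<open>g\<close> vanishes off the translate of \<open>U\<close> by \<open>x\<close>,
  the indicator in \<open>hitting_bound\<close> changes nothing along the path from
  \<open>x\<close>.\<close>

lemma restricted_occupation_le:
  assumes a: "0 \<le> a" and U: "open U" and [measurable]: "g \<in> borel_measurable borel"
    and g: "\<And>z. z \<notin> U \<Longrightarrow> g (x + z) = 0"
    and B: "\<And>y. y \<in> U \<Longrightarrow> occupation {0..b - a} g (x + y) \<le> B"
  shows "occupation {a..b} g x \<le> emeasure M (hits {a..b} U) * B"
proof -
  have "occupation {a..b} g x = occupation {a..b} (\<lambda>z. indicator U (z - x) * g z) x"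
    by (rule occupation_cong) (use g in \<open>auto split: split_indicator\<close>)
  also have "\<dots> \<le> emeasure M (hits {a..b} U) * B"
    using a U B by (intro hitting_bound) auto
  finally show ?thesis .
qed

text \<open>The hitting estimate with \<open>U = UNIV\<close> serves as the Markov property at time
  \<open>a\<close>: the occupation over the next period of length \<open>b\<close> is at most the
  supremum over all starting points.\<close>

lemma SUP_occupation_add_le:
  assumes [measurable]: "f \<in> borel_measurable borel" and a: "0 \<le> a"
  shows "(\<Squnion>x. occupation {0..a + b} f x) \<le> (\<Squnion>x. occupation {0..a} f x) + (\<Squnion>x. occupation {0..b} f x)"
proof (rule SUP_least)
  fix x
  have "occupation {0..a + b} f x \<le> occupation {0..a} f x + occupation {a..a + b} f x"
    by (intro occupation_Un_le) auto
  also have "occupation {a..a + b} f x \<le> emeasure M (hits {a..a + b} UNIV) * (\<Squnion>x. occupation {0..b} f x)"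
    by (intro restricted_occupation_le a) (auto intro: SUP_upper)
  also have "\<dots> \<le> 1 * (\<Squnion>x. occupation {0..b} f x)"
    by (intro mult_right_mono emeasure_le_1) auto
  finally show "occupation {0..a + b} f x \<le> (\<Squnion>x. occupation {0..a} f x) + (\<Squnion>x. occupation {0..b} f x)"
    using SUP_upper[of x UNIV "occupation {0..a} f"] by (auto intro: order_trans add_mono)
qed

text \<open>Finitely many periods of length \<open>t\<close> cover \<open>{0..b}\<close>, and by
  subadditivity each contributes at most the finite supremum for \<open>t\<close>.\<close>

lemma SUP_occupation_finite:
  assumes [measurable]: "f \<in> borel_measurable borel" and t: "0 < t" and fin: "(\<Squnion>x. occupation {0..t} f x) < \<infinity>"
  shows "(\<Squnion>x. occupation {0..b} f x) < \<infinity>"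
proof -
  have step: "(\<Squnion>x. occupation {0..real (Suc k) * t} f x) < \<infinity>" for k
  proof (induction k)
    case 0
    then show ?case using fin by simp
  next
    case (Suc k)
    have "real (Suc (Suc k)) * t = t + real (Suc k) * t" by (simp add: algebra_simps)
    then have "(\<Squnion>x. occupation {0..real (Suc (Suc k)) * t} f x) \<le>
          (\<Squnion>x. occupation {0..t} f x) + (\<Squnion>x. occupation {0..real (Suc k) * t} f x)"
      using SUP_occupation_add_le[of f t "real (Suc k) * t"] t by simp
    also have "\<dots> < \<infinity>" using fin Suc by simp
    finally show ?case .
  qed
  obtain k where "b < real k * t" using reals_Archimedean3[OF t] by blast
  also have "\<dots> \<le> real (Suc k) * t" using t by simp
  finally have "(\<Squnion>x. occupation {0..b} f x) \<le> (\<Squnion>x. occupation {0..real (Suc k) * t} f x)"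
    by (intro SUP_mono) (auto intro!: exI occupation_mono)
  then show ?thesis using step[of k] by (rule le_less_trans)
qed

text \<open>Split at the ball of radius \<open>r\<close> around the starting point. Inside, at times
  below \<open>1 / c\<close> the weight \<open>exp (- c * u)\<close> is at least
  \<open>exp (- 1)\<close>, so the resolvent quantity controls the occupation. Outside,
  \<open>hitting_bound\<close> gives at most half of the supremum, which is absorbed.\<close>

lemma resolvent_imp_semigroup:
  assumes [measurable]: "f \<in> borel_measurable borel" and c: "0 < c"
    and lim: "((\<lambda>r. \<Squnion>x. \<integral>\<^sup>+\<omega>. (\<integral>\<^sup>+u\<in>{0..}. ennreal (exp (- c * u)) *
      indicator (ball x r) (x + X u \<omega>) * f (x + X u \<omega>) \<partial>lborel) \<partial>M) \<longlongrightarrow> 0) (at_right 0)"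
  shows "((\<lambda>t. \<Squnion>x. occupation {0..t} f x) \<longlongrightarrow> 0) (at_right 0)"
  unfolding tendsto_zero_at_right_iff
proof (intro allI impI)
  fix \<epsilon> :: real assume \<epsilon>: "0 < \<epsilon>"
  define R where "R r = (\<Squnion>x. \<integral>\<^sup>+\<omega>. (\<integral>\<^sup>+u\<in>{0..}. ennreal (exp (- c * u)) *
      indicator (ball x r) (x + X u \<omega>) * f (x + X u \<omega>) \<partial>lborel) \<partial>M)" for r
  \<comment> \<open>After the factor \<open>exp 1\<close> from the weight and the factor 2 from
    absorption the bound is exactly \<epsilon>.\<close>
  define \<delta> where "\<delta> = \<epsilon> / (2 * exp 1)"
  have "0 < \<delta>" using \<epsilon> by (simp add: \<delta>_def)
  then obtain r0 where r0: "r0 > 0" "\<And>r. 0 < r \<Longrightarrow> r < r0 \<Longrightarrow> R r \<le> ennreal \<delta>"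
    using lim unfolding tendsto_zero_at_right_iff R_def by blast
  define r where "r = r0 / 2"
  have r: "0 < r" "R r \<le> ennreal \<delta>" using r0 by (auto simp: r_def)
  obtain t0 where t0: "0 < t0" "emeasure M (hits {0..t0} {z. r / 2 < norm z}) < ennreal (1/2)"
    using exit_probability_small[OF _ half_pos, of "r / 2"] r(1) by (metis half_gt_zero)
  show "\<exists>b>0. \<forall>t. 0 < t \<and> t < b \<longrightarrow> (\<Squnion>x. occupation {0..t} f x) \<le> ennreal \<epsilon>"
  proof (intro exI[of _ "min t0 (1 / c)"] conjI allI impI SUP_least)
    show "0 < min t0 (1 / c)" using t0 c by simp
    fix t x assume t: "0 < t \<and> t < min t0 (1 / c)"
    \<comment> \<open>With radius \<open>r / 2\<close> the set \<open>U\<close> is open and,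
      together with \<open>ball 0 r\<close>, covers the space.\<close>
    define U where "U = {z :: 'a. r / 2 < norm z}"
    have U [measurable]: "open U" "U \<in> sets borel"
      unfolding U_def by (auto intro!: open_Collect_less continuous_intros)
    show "occupation {0..t} f x \<le> ennreal \<epsilon>"
    proof (rule occupation_truncate_le)
      fix n :: nat
      let ?f = "\<lambda>z. min (f z) (of_nat n)"
      define S where "S = (\<Squnion>x. occupation {0..t} ?f x)"
      have "occupation {0..t} ?f y \<le> of_nat n * ennreal t" for y
      proof -
        have "occupation {0..t} ?f y \<le> (\<integral>\<^sup>+u\<in>{0..t}. (\<integral>\<^sup>+\<omega>. of_nat n \<partial>M) \<partial>lborel)"
          unfolding occupation_def by (intro nn_integral_mono mult_right_mono) auto
        also have "\<dots> = of_nat n * ennreal t"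
          using t by (simp add: emeasure_space_1 nn_integral_cmult)
        finally show ?thesis .
      qed
      then have "S \<le> of_nat n * ennreal t" unfolding S_def by (rule SUP_least)
      also have "\<dots> < \<infinity>" by (simp add: ennreal_mult_less_top of_nat_less_top)
      finally have S_fin: "S < \<infinity>" .
      have "S \<le> ennreal (exp 1 * \<delta>) + ennreal (1/2) * S"
        unfolding S_def
      proof (rule SUP_least, fold S_def)
        fix y
        have "occupation {0..t} ?f y \<le>
            occupation {0..t} (\<lambda>z. indicator (ball y r) z * ?f z + indicator U (z - y) * ?f z) y"
        proof (rule occupation_mono)
          fix z
          show "?f z \<le> indicator (ball y r) z * ?f z + indicator U (z - y) * ?f z"
            using r(1) by (auto simp: U_def dist_norm norm_minus_commute split: split_indicator)
        qed simp
        also have "\<dots> = occupation {0..t} (\<lambda>z. indicator (ball y r) z * ?f z) y +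
                          occupation {0..t} (\<lambda>z. indicator U (z - y) * ?f z) y"
          by (rule occupation_add) measurable
        also have "\<dots> \<le> ennreal (exp 1 * \<delta>) + ennreal (1/2) * S"
        proof (rule add_mono)
          have "occupation {0..t} (\<lambda>z. indicator (ball y r) z * ?f z) y \<le>
              (\<integral>\<^sup>+\<omega>. (\<integral>\<^sup>+u. ennreal (exp 1) * (ennreal (exp (- c * u)) *
                 indicator (ball y r) (y + X u \<omega>) * f (y + X u \<omega>) * indicator {0..} u) \<partial>lborel) \<partial>M)"
          proof (subst occupation_path; (intro nn_integral_mono)?)
            fix \<omega> u
            show "indicator (ball y r) (y + X u \<omega>) * ?f (y + X u \<omega>) * indicator {0..t} u \<le>
              ennreal (exp 1) * (ennreal (exp (- c * u)) *
                 indicator (ball y r) (y + X u \<omega>) * f (y + X u \<omega>) * indicator {0..} u)"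
            proof (cases "u \<in> {0..t}")
              case True
              then have "c * u \<le> c * t" using c by (intro mult_left_mono) auto
              also have "\<dots> \<le> 1" using t c by (simp add: field_simps)
              finally have "1 \<le> exp (1 - c * u)" by simp
              then have "1 \<le> exp 1 * exp (- c * u)" by (simp add: exp_add[symmetric])
              then have "1 \<le> ennreal (exp 1) * ennreal (exp (- c * u))"
                by (metis ennreal_leI ennreal_1 ennreal_mult exp_ge_zero)
              then have "1 * (indicator (ball y r) (y + X u \<omega>) * ?f (y + X u \<omega>)) \<le>
                  (ennreal (exp 1) * ennreal (exp (- c * u))) * (indicator (ball y r) (y + X u \<omega>) * f (y + X u \<omega>))"
                by (intro mult_mono) auto
              then show ?thesis using True by (simp add: mult.assoc)
            qed simp
          qed measurable
          also have "\<dots> = ennreal (exp 1) * (\<integral>\<^sup>+\<omega>. (\<integral>\<^sup>+u\<in>{0..}. ennreal (exp (- c * u)) *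
                 indicator (ball y r) (y + X u \<omega>) * f (y + X u \<omega>) \<partial>lborel) \<partial>M)"
            by (subst nn_integral_cmult[symmetric], measurable)
               (intro nn_integral_cong nn_integral_cmult, measurable)
          also have "\<dots> \<le> ennreal (exp 1) * R r"
            unfolding R_def by (intro mult_left_mono SUP_upper) auto
          also have "\<dots> \<le> ennreal (exp 1) * ennreal \<delta>"
            by (intro mult_left_mono r(2)) auto
          also have "\<dots> = ennreal (exp 1 * \<delta>)"
            using \<open>0 < \<delta>\<close> by (simp add: ennreal_mult)
          finally show "occupation {0..t} (\<lambda>z. indicator (ball y r) z * ?f z) y \<le> ennreal (exp 1 * \<delta>)" .
        next
          have "occupation {0..t} (\<lambda>z. indicator U (z - y) * ?f z) y \<le> emeasure M (hits {0..t} U) * S"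
            unfolding S_def by (intro hitting_bound U) (auto intro: SUP_upper)
          also have "\<dots> \<le> emeasure M (hits {0..t0} U) * S"
            using t by (intro mult_right_mono emeasure_mono hits_mono) auto
          also have "\<dots> \<le> ennreal (1/2) * S"
            using t0(2) by (intro mult_right_mono) (auto simp: U_def less_imp_le)
          finally show "occupation {0..t} (\<lambda>z. indicator U (z - y) * ?f z) y \<le> ennreal (1/2) * S" .
        qed
        finally show "occupation {0..t} ?f y \<le> ennreal (exp 1 * \<delta>) + ennreal (1/2) * S" .
      qed
      then have "S \<le> 2 * ennreal (exp 1 * \<delta>)"
        using S_fin by (rule ennreal_le_double)
      also have "\<dots> = ennreal \<epsilon>"
        using \<epsilon> by (simp add: \<delta>_def flip: ennreal_numeral ennreal_mult)
      finally show "occupation {0..t} ?f x \<le> ennreal \<epsilon>"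
        unfolding S_def by (rule order_trans[rotated]) (rule SUP_upper, simp)
    qed simp_all
  qed
qed

text \<open>Two points of \<open>ball x r\<close> differ by less than 2 in norm, so a return to the
  ball after time \<open>T\<close> is a visit of the path from 0 to \<open>ball 0 2\<close>, of
  probability at most 1/2. Absorption applies because the occupation up to the finite time
  \<open>b\<close> is finite; the resulting bound does not depend on \<open>b\<close>.\<close>

lemma local_occupation_le:
  assumes [measurable]: "f \<in> borel_measurable borel"
    and T: "0 \<le> T" "emeasure M (hits {T..} (ball 0 2)) \<le> ennreal (1/2)"
    and fin: "\<And>b. (\<Squnion>y. occupation {0..b} f y) < \<infinity>"
    and r: "r \<le> 1" and y: "y \<in> ball x r"
  shows "occupation {0..b} (\<lambda>z. indicator (ball x r) z * f z) y \<le> 2 * (\<Squnion>y. occupation {0..T} f y)"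
proof -
  let ?g = "\<lambda>z. indicator (ball x r) z * f z"
  define s where "s = (\<Squnion>y\<in>ball x r. occupation {0..b} ?g y)"
  have [measurable]: "?g \<in> borel_measurable borel" by measurable
  have g_le: "?g z \<le> f z" for z by (simp split: split_indicator)
  have "s \<le> (\<Squnion>y. occupation {0..b} f y)"
    unfolding s_def by (intro SUP_mono) (auto intro!: exI occupation_mono g_le)
  with fin[of b] have "s < \<infinity>" by (rule le_less_trans[rotated])
  have "s \<le> (\<Squnion>y. occupation {0..T} f y) + ennreal (1/2) * s"
    unfolding s_def
  proof (rule SUP_least, fold s_def)
    fix w assume w: "w \<in> ball x r"
    have "occupation {0..b} ?g w \<le> occupation {0..T} ?g w + occupation {T..b} ?g w"
      by (intro occupation_Un_le) auto
    also have "\<dots> \<le> (\<Squnion>y. occupation {0..T} f y) + ennreal (1/2) * s"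
    proof (rule add_mono)
      show "occupation {0..T} ?g w \<le> (\<Squnion>y. occupation {0..T} f y)"
        by (rule SUP_upper2[of w]) (auto intro: occupation_mono g_le)
      define U where "U = (\<lambda>z. w + z) -` ball x r"
      have U: "open U"
        unfolding U_def by (intro open_vimage open_ball continuous_intros)
      then have [measurable]: "U \<in> sets borel" by simp
      have "U \<subseteq> ball 0 2"
      proof
        fix z assume "z \<in> U"
        then have "norm (x - (w + z)) < r" "norm (x - w) < r"
          using w by (auto simp: U_def dist_norm)
        moreover have "norm z \<le> norm (x - w) + norm (x - (w + z))"
          using norm_triangle_ineq4[of "x - w" "x - (w + z)"] by simp
        ultimately show "z \<in> ball 0 2" using r by simp
      qed
      have "occupation {T..b} ?g w \<le> emeasure M (hits {T..b} U) * s"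
      proof (rule restricted_occupation_le[OF T(1) U])
        show "?g (w + z) = 0" if "z \<notin> U" for z
          using that by (simp add: U_def)
        show "occupation {0..b - T} ?g (w + z) \<le> s" if "z \<in> U" for z
          unfolding s_def
          by (rule SUP_upper2[of "w + z"]) (use that T(1) in \<open>auto simp: U_def intro: occupation_mono\<close>)
      qed simp
      also have "\<dots> \<le> emeasure M (hits {T..} (ball 0 2)) * s"
        using \<open>U \<subseteq> ball 0 2\<close> by (intro mult_right_mono emeasure_mono hits_mono) auto
      also have "\<dots> \<le> ennreal (1/2) * s"
        by (intro mult_right_mono T) auto
      finally show "occupation {T..b} ?g w \<le> ennreal (1/2) * s" .
    qed
    finally show "occupation {0..b} ?g w \<le> (\<Squnion>y. occupation {0..T} f y) + ennreal (1/2) * s" .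
  qed
  then have "s \<le> 2 * (\<Squnion>y. occupation {0..T} f y)"
    using \<open>s < \<infinity>\<close> by (rule ennreal_le_double)
  then show ?thesis
    unfolding s_def by (rule order_trans[rotated]) (rule SUP_upper, rule y)
qed

lemma semigroup_imp_potential:
  assumes [measurable]: "f \<in> borel_measurable borel"
    and tr: "transient M X" and polar: "AE \<omega> in M. \<forall>u>0. X u \<omega> \<noteq> 0"
    and lim: "((\<lambda>t. \<Squnion>x. occupation {0..t} f x) \<longlongrightarrow> 0) (at_right 0)"
  shows "((\<lambda>r. \<Squnion>x. occupation {0..} (\<lambda>z. indicator (ball x r) z * f z) x) \<longlongrightarrow> 0) (at_right 0)"
  unfolding tendsto_zero_at_right_iff
proof (intro allI impI)
  fix \<epsilon> :: real assume \<epsilon>: "0 < \<epsilon>"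
  have small: "\<exists>t>0. (\<Squnion>x. occupation {0..t} f x) \<le> ennreal \<delta>" if "0 < \<delta>" for \<delta>
  proof -
    obtain b where "0 < b" "\<And>t. 0 < t \<Longrightarrow> t < b \<Longrightarrow> (\<Squnion>x. occupation {0..t} f x) \<le> ennreal \<delta>"
      using lim \<open>0 < \<delta>\<close> unfolding tendsto_zero_at_right_iff by blast
    then show ?thesis by (intro exI[of _ "b / 2"]) simp
  qed
  \<comment> \<open>Smallness at one time gives finiteness at every time, which
    \<open>local_occupation_le\<close> needs for absorption.\<close>
  have fin: "(\<Squnion>x. occupation {0..b} f x) < \<infinity>" for b
  proof -
    obtain t where "0 < t" "(\<Squnion>x. occupation {0..t} f x) \<le> ennreal 1"
      using small[of 1] by auto
    moreover from this have "(\<Squnion>x. occupation {0..t} f x) < \<infinity>"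
      using le_less_trans ennreal_less_top by fastforce
    ultimately show ?thesis using SUP_occupation_finite[of f t b] by simp
  qed
  obtain T where T: "0 < T" "emeasure M (hits {T..} (ball 0 2)) < ennreal (1/2)"
    using transient_hits_small[OF tr half_pos] by metis
  obtain C where C: "0 \<le> C" "(\<Squnion>x. occupation {0..T} f x) = ennreal C"
    using fin[of T] by (cases "\<Squnion>x. occupation {0..T} f x") auto
  obtain t where t: "0 < t" "(\<Squnion>x. occupation {0..t} f x) \<le> ennreal (\<epsilon> / 2)"
    using small[of "\<epsilon> / 2"] \<epsilon> by auto
  \<comment> \<open>Chosen so that the probability of a visit after \<open>t\<close> times the
    occupation bound \<open>2 * C\<close> is at most half of \<epsilon>; \<open>C + 1\<close> avoids
    division by 0.\<close>
  define \<delta> where "\<delta> = \<epsilon> / (4 * (C + 1))"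
  have "0 < \<delta>" using \<epsilon> C by (simp add: \<delta>_def)
  then obtain r0 where r0: "0 < r0" "r0 \<le> 1" "emeasure M (hits {t..} (ball 0 r0)) < ennreal \<delta>"
    using \<open>0 < \<delta>\<close> by (auto intro: polar_hits_small[OF tr polar t(1), of "ennreal \<delta>"])
  have \<delta>_le: "\<delta> * (2 * C) \<le> \<epsilon> / 2"
    using \<epsilon> C by (simp add: \<delta>_def field_simps)
  show "\<exists>b>0. \<forall>r. 0 < r \<and> r < b \<longrightarrow>
          (\<Squnion>x. occupation {0..} (\<lambda>z. indicator (ball x r) z * f z) x) \<le> ennreal \<epsilon>"
  proof (intro exI[of _ r0] conjI allI impI SUP_least r0(1))
    fix r x assume r: "0 < r \<and> r < r0"
    let ?g = "\<lambda>z. indicator (ball x r) z * f z"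
    have [measurable]: "?g \<in> borel_measurable borel" by measurable
    show "occupation {0..} ?g x \<le> ennreal \<epsilon>"
    proof (rule occupation_atLeast_le)
      fix n :: nat
      \<comment> \<open>Before \<open>t\<close> the semigroup condition controls the occupation.
        After \<open>t\<close> the ball is visited with probability below \<delta>, and from each
        point of the ball the occupation is at most \<open>2 * C\<close>.\<close>
      have "occupation {0..real n} ?g x \<le> occupation {0..t} ?g x + occupation {t..real n} ?g x"
        by (intro occupation_Un_le) auto
      also have "\<dots> \<le> ennreal (\<epsilon> / 2) + ennreal (\<epsilon> / 2)"
      proof (rule add_mono)
        have "occupation {0..t} ?g x \<le> occupation {0..t} f x"
          by (rule occupation_mono) (auto split: split_indicator)
        also have "\<dots> \<le> (\<Squnion>x. occupation {0..t} f x)" by (rule SUP_upper) simp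
        finally show "occupation {0..t} ?g x \<le> ennreal (\<epsilon> / 2)"
          using t(2) by (rule order_trans)
        have "occupation {t..real n} ?g x \<le> emeasure M (hits {t..real n} (ball 0 r)) * (2 * ennreal C)"
        proof (rule restricted_occupation_le)
          show "?g (x + z) = 0" if "z \<notin> ball 0 r" for z
            using that by (simp add: dist_norm)
          show "occupation {0..real n - t} ?g (x + y) \<le> 2 * ennreal C" if "y \<in> ball 0 r" for y
            unfolding C(2)[symmetric]
            using that T r r0(2) by (intro local_occupation_le fin) (auto simp: dist_norm)
        qed (use t in auto)
        also have "\<dots> \<le> emeasure M (hits {t..} (ball 0 r0)) * (2 * ennreal C)"
          using r by (intro mult_right_mono emeasure_mono hits_mono subset_ball) auto
        also have "\<dots> \<le> ennreal \<delta> * (2 * ennreal C)"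
          using r0(3) by (intro mult_right_mono) auto
        also have "\<dots> = ennreal (\<delta> * (2 * C))"
          using \<open>0 < \<delta>\<close> C(1) by (simp add: ennreal_mult)
        also have "\<dots> \<le> ennreal (\<epsilon> / 2)"
          using \<delta>_le by (rule ennreal_leI)
        finally show "occupation {t..real n} ?g x \<le> ennreal (\<epsilon> / 2)" .
      qed
      also have "\<dots> = ennreal \<epsilon>" using \<epsilon> by (simp flip: ennreal_plus)
      finally show "occupation {0..real n} ?g x \<le> ennreal \<epsilon>" .
    qed simp
  qed
qed

end

section \<open>The Kato classes\<close>

context regular_levy_process
begin

text \<open>The potential measure is the image of Lebesgue measure on \<open>{0..}\<close> times
  \<open>M\<close> under the map taking \<open>(u, \<omega>)\<close> to \<open>X u \<omega>\<close>;
  identifying the two on Borel sets gives the change of variables.\<close>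

lemma nn_integral_potential_measure:
  assumes [measurable]: "f \<in> borel_measurable borel"
  shows "(\<integral>\<^sup>+z. f z \<partial>potential_measure M X) = occupation {0..} f 0"
proof -
  let ?L = "lborel \<Otimes>\<^sub>M M"
  let ?D = "density ?L (\<lambda>p. indicator {0..} (fst p))"
  have "potential_measure M X = distr ?D borel (\<lambda>p. X (fst p) (snd p))"
  proof (rule measure_eqI)
    fix B assume "B \<in> sets (potential_measure M X)"
    then have B [measurable]: "B \<in> sets borel" by simp
    have "emeasure (distr ?D borel (\<lambda>p. X (fst p) (snd p))) B =
        (\<integral>\<^sup>+p. indicator {0..} (fst p) * indicator B (X (fst p) (snd p)) \<partial>?L)"
      by (simp add: nn_integral_distr nn_integral_density flip: nn_integral_indicator)
    also have "\<dots> = (\<integral>\<^sup>+u. (\<integral>\<^sup>+\<omega>. indicator {0..} u * indicator B (X u \<omega>) \<partial>M) \<partial>lborel)"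
      by (subst nn_integral_fst[symmetric]) simp_all
    also have "\<dots> = (\<integral>\<^sup>+u\<in>{0..}. emeasure M {\<omega> \<in> space M. X u \<omega> \<in> B} \<partial>lborel)"
    proof (rule nn_integral_cong)
      fix u
      have "(\<integral>\<^sup>+\<omega>. indicator B (X u \<omega>) \<partial>M) = (\<integral>\<^sup>+\<omega>. indicator {\<omega> \<in> space M. X u \<omega> \<in> B} \<omega> \<partial>M)"
        by (intro nn_integral_cong) (auto split: split_indicator)
      also have "\<dots> = emeasure M {\<omega> \<in> space M. X u \<omega> \<in> B}"
        by (subst nn_integral_indicator) simp_all
      finally show "(\<integral>\<^sup>+\<omega>. indicator {0..} u * indicator B (X u \<omega>) \<partial>M) =
          emeasure M {\<omega> \<in> space M. X u \<omega> \<in> B} * indicator {0..} u"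
        by (auto split: split_indicator)
    qed
    finally show "emeasure (potential_measure M X) B = emeasure (distr ?D borel (\<lambda>p. X (fst p) (snd p))) B"
      using emeasure_potential_measure[OF B] by simp
  qed simp
  then have "(\<integral>\<^sup>+z. f z \<partial>potential_measure M X) =
      (\<integral>\<^sup>+p. indicator {0..} (fst p) * f (X (fst p) (snd p)) \<partial>?L)"
    by (simp add: nn_integral_distr nn_integral_density)
  also have "\<dots> = (\<integral>\<^sup>+u. (\<integral>\<^sup>+\<omega>. indicator {0..} u * f (X u \<omega>) \<partial>M) \<partial>lborel)"
    by (subst nn_integral_fst[symmetric]) simp_all
  also have "\<dots> = occupation {0..} f 0"
    unfolding occupation_def by (intro nn_integral_cong) (auto split: split_indicator)
  finally show ?thesis .
qed

text \<open>Translation by \<open>x\<close> turns the path from 0 into the path from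
  \<open>x\<close> and \<open>ball 0 r\<close> into \<open>ball x r\<close>.\<close>

lemma nn_integral_ball_potential_measure:
  assumes [measurable]: "q \<in> borel_measurable borel"
  shows "(\<integral>\<^sup>+z\<in>ball 0 r. ennreal \<bar>q (z + x)\<bar> \<partial>potential_measure M X) =
         occupation {0..} (\<lambda>z. indicator (ball x r) z * ennreal \<bar>q z\<bar>) x"
proof -
  have "(\<integral>\<^sup>+z\<in>ball 0 r. ennreal \<bar>q (z + x)\<bar> \<partial>potential_measure M X) =
        occupation {0..} (\<lambda>z. ennreal \<bar>q (z + x)\<bar> * indicator (ball 0 r) z) 0"
    by (rule nn_integral_potential_measure) measurable
  also have "\<dots> = occupation {0..} (\<lambda>z. indicator (ball x r) z * ennreal \<bar>q z\<bar>) x"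
  proof -
    have "(\<integral>\<^sup>+\<omega>. ennreal \<bar>q (0 + X u \<omega> + x)\<bar> * indicator (ball 0 r) (0 + X u \<omega>) \<partial>M) =
          (\<integral>\<^sup>+\<omega>. indicator (ball x r) (x + X u \<omega>) * ennreal \<bar>q (x + X u \<omega>)\<bar> \<partial>M)" for u
      by (intro nn_integral_cong) (simp add: dist_norm add.commute indicator_def)
    then show ?thesis
      unfolding occupation_def by simp
  qed
  finally show ?thesis .
qed

text \<open>A cycle of inclusions. The potential condition implies the resolvent one since the
  exponential weight is at most 1; the others are \<open>resolvent_imp_semigroup\<close> and
  \<open>semigroup_imp_potential\<close>.\<close>

lemma kato_classes_eq:
  assumes tr: "transient M X" and polar: "zero_polar M X"
  shows "kato_potential M X = kato_resolvent M X" "kato_resolvent M X = kato_semigroup M X"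
proof -
  have avoid: "AE \<omega> in M. \<forall>u>0. X u \<omega> \<noteq> 0"
    using polar[unfolded zero_polar_def AE_from_def, rule_format, of 0] by simp
  have semigroup_iff: "q \<in> kato_semigroup M X \<longleftrightarrow> q \<in> borel_measurable borel \<and>
      ((\<lambda>t. \<Squnion>x. occupation {0..t} (\<lambda>z. ennreal \<bar>q z\<bar>) x) \<longlongrightarrow> 0) (at_right 0)" for q
  proof -
    have "expectation_from M X x (\<lambda>Y. \<integral>\<^sup>+u\<in>{0..t}. ennreal \<bar>q (Y u)\<bar> \<partial>lborel) =
        occupation {0..t} (\<lambda>z. ennreal \<bar>q z\<bar>) x" if [measurable]: "q \<in> borel_measurable borel" for x t
      unfolding expectation_from_def by (subst occupation_path) simp_all
    then show ?thesis by (auto simp: kato_semigroup_def)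
  qed
  have "kato_potential M X \<subseteq> kato_resolvent M X"
  proof
    fix q assume "q \<in> kato_potential M X"
    then have q [measurable]: "q \<in> borel_measurable borel"
      and lim: "((\<lambda>r. \<Squnion>x. occupation {0..} (\<lambda>z. indicator (ball x r) z * ennreal \<bar>q z\<bar>) x) \<longlongrightarrow> 0) (at_right 0)"
      by (auto simp: kato_potential_def nn_integral_ball_potential_measure)
    \<comment> \<open>The witness for the rate in \<open>kato_resolvent\<close> is
      \<open>c = 1\<close>; the factor in \<open>- 1 * u\<close> is kept to match the
      definition.\<close>
    have "expectation_from M X x (\<lambda>Y. \<integral>\<^sup>+u\<in>{0..}. ennreal (exp (- 1 * u)) * indicator (ball x r) (Y u) *
            ennreal \<bar>q (Y u)\<bar> \<partial>lborel) \<le> occupation {0..} (\<lambda>z. indicator (ball x r) z * ennreal \<bar>q z\<bar>) x" for x r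
    proof (subst occupation_path)
      show "expectation_from M X x (\<lambda>Y. \<integral>\<^sup>+u\<in>{0..}. ennreal (exp (- 1 * u)) * indicator (ball x r) (Y u) *
            ennreal \<bar>q (Y u)\<bar> \<partial>lborel) \<le>
          (\<integral>\<^sup>+\<omega>. (\<integral>\<^sup>+u\<in>{0..}. (indicator (ball x r) (x + X u \<omega>) * ennreal \<bar>q (x + X u \<omega>)\<bar>) \<partial>lborel) \<partial>M)"
        unfolding expectation_from_def
      proof (intro nn_integral_mono)
        fix \<omega> and u :: real
        have "ennreal (exp (- u)) * a \<le> a" if "0 \<le> u" for a
          using mult_right_mono[of "ennreal (exp (- u))" 1 a] that by simp
        then show "ennreal (exp (- 1 * u)) * indicator (ball x r) (x + X u \<omega>) * ennreal \<bar>q (x + X u \<omega>)\<bar> *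
              indicator {0..} u \<le>
            indicator (ball x r) (x + X u \<omega>) * ennreal \<bar>q (x + X u \<omega>)\<bar> * indicator {0..} u"
          by (cases "0 \<le> u") (auto simp: mult.assoc)
      qed
    qed measurable
    then have le: "(\<Squnion>x. expectation_from M X x (\<lambda>Y. \<integral>\<^sup>+u\<in>{0..}. ennreal (exp (- 1 * u)) *
            indicator (ball x r) (Y u) * ennreal \<bar>q (Y u)\<bar> \<partial>lborel)) \<le>
          (\<Squnion>x. occupation {0..} (\<lambda>z. indicator (ball x r) z * ennreal \<bar>q z\<bar>) x)" for r
      by (intro SUP_mono) auto
    have "((\<lambda>r. \<Squnion>x. expectation_from M X x (\<lambda>Y. \<integral>\<^sup>+u\<in>{0..}. ennreal (exp (- 1 * u)) *
            indicator (ball x r) (Y u) * ennreal \<bar>q (Y u)\<bar> \<partial>lborel)) \<longlongrightarrow> 0) (at_right (0::real))"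
      by (rule tendsto_sandwich[OF _ _ tendsto_const lim]) (use le in auto)
    then show "q \<in> kato_resolvent M X"
      unfolding kato_resolvent_def using q zero_less_one by blast
  qed
  moreover have "kato_resolvent M X \<subseteq> kato_semigroup M X"
  proof
    fix q assume "q \<in> kato_resolvent M X"
    then obtain c where q [measurable]: "q \<in> borel_measurable borel" and c: "0 < c"
      "((\<lambda>r. \<Squnion>x. expectation_from M X x (\<lambda>Y. \<integral>\<^sup>+u\<in>{0..}. ennreal (exp (- c * u)) *
         indicator (ball x r) (Y u) * ennreal \<bar>q (Y u)\<bar> \<partial>lborel)) \<longlongrightarrow> 0) (at_right (0::real))"
      unfolding kato_resolvent_def by blast
    have "((\<lambda>t. \<Squnion>x. occupation {0..t} (\<lambda>z. ennreal \<bar>q z\<bar>) x) \<longlongrightarrow> 0) (at_right 0)"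
      by (rule resolvent_imp_semigroup[OF _ c(1) c(2)[unfolded expectation_from_def]]) measurable
    then show "q \<in> kato_semigroup M X"
      by (simp add: semigroup_iff)
  qed
  moreover have "kato_semigroup M X \<subseteq> kato_potential M X"
  proof
    fix q assume "q \<in> kato_semigroup M X"
    then have q [measurable]: "q \<in> borel_measurable borel"
      and lim: "((\<lambda>t. \<Squnion>x. occupation {0..t} (\<lambda>z. ennreal \<bar>q z\<bar>) x) \<longlongrightarrow> 0) (at_right 0)"
      by (auto simp: semigroup_iff)
    have "((\<lambda>r. \<Squnion>x. occupation {0..} (\<lambda>z. indicator (ball x r) z * ennreal \<bar>q z\<bar>) x) \<longlongrightarrow> 0) (at_right 0)"
      by (rule semigroup_imp_potential[OF _ tr avoid lim]) measurable
    then show "q \<in> kato_potential M X"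
      by (simp add: kato_potential_def nn_integral_ball_potential_measure)
  qed
  ultimately show "kato_potential M X = kato_resolvent M X" "kato_resolvent M X = kato_semigroup M X"
    by blast+
qed

end

section \<open>Passage to a version with regular paths\<close>

lemma cadlag_cong:
  assumes "\<And>t. 0 \<le> t \<Longrightarrow> f t = g t" "cadlag f"
  shows "cadlag g"
proof -
  have "(f \<longlongrightarrow> l) (at_right t) \<longleftrightarrow> (g \<longlongrightarrow> l) (at_right t)" if "0 \<le> t" for l t
    by (rule tendsto_cong) (use that assms(1) in \<open>auto simp: eventually_at_filter\<close>)
  moreover have "(f \<longlongrightarrow> l) (at_left t) \<longleftrightarrow> (g \<longlongrightarrow> l) (at_left t)" if "0 < t" for l t
    by (rule tendsto_cong, rule eventually_at_leftI[of 0]) (use that assms(1) in auto)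
  ultimately show ?thesis
    using assms unfolding cadlag_def by auto
qed

text \<open>Independence says that the joint law is the product of the marginals, and almost sure
  equality of finitely many variables leaves both sides unchanged. The empty family is separate
  because this characterisation is applied to nonempty index sets.\<close>

lemma (in prob_space) indep_vars_AE_cong:
  assumes "finite I" and rv: "\<And>i. i \<in> I \<Longrightarrow> random_variable (N i) (Y i)" "\<And>i. i \<in> I \<Longrightarrow> random_variable (N i) (Z i)"
    and eq: "\<And>i. i \<in> I \<Longrightarrow> AE \<omega> in M. Y i \<omega> = Z i \<omega>"
    and ind: "indep_vars N Y I"
  shows "indep_vars N Z I"
proof (cases "I = {}")
  case True
  then show ?thesis
    by (simp add: indep_vars_def indep_sets_def)
next
  case False
  have "AE \<omega> in M. \<forall>i\<in>I. Y i \<omega> = Z i \<omega>"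
    using eq \<open>finite I\<close> by (subst AE_finite_all) auto
  then have "distr M (\<Pi>\<^sub>M i\<in>I. N i) (\<lambda>\<omega>. \<lambda>i\<in>I. Z i \<omega>) = distr M (\<Pi>\<^sub>M i\<in>I. N i) (\<lambda>\<omega>. \<lambda>i\<in>I. Y i \<omega>)"
    by (intro distr_cong_AE) (auto elim!: eventually_mono intro!: restrict_ext measurable_restrict rv)
  also have "\<dots> = (\<Pi>\<^sub>M i\<in>I. distr M (N i) (Y i))"
    using ind False by (subst (asm) indep_vars_iff_distr_eq_PiM') (auto intro: rv)
  also have "\<dots> = (\<Pi>\<^sub>M i\<in>I. distr M (N i) (Z i))"
    by (intro PiM_cong distr_cong_AE refl eq) (auto intro: rv)
  finally show ?thesis
    using False by (subst indep_vars_iff_distr_eq_PiM') (auto intro: rv)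
qed

text \<open>Apart from measurability, which is assumed, the defining properties concern laws or
  almost sure behaviour at nonnegative times, so they survive a change on a null set.\<close>

lemma (in levy_process) levy_process_modification:
  assumes meas: "\<And>t. 0 \<le> t \<Longrightarrow> Y t \<in> borel_measurable M"
    and eq: "AE \<omega> in M. \<forall>t\<ge>0. Y t \<omega> = X t \<omega>"
  shows "levy_process M Y"
proof unfold_locales
  have eq_at: "AE \<omega> in M. Y t \<omega> = X t \<omega>" if "0 \<le> t" for t
    using eq by eventually_elim (use that in simp)
  show "Y t \<in> borel_measurable M" if "0 \<le> t" for t
    using that by (rule meas)
  show "AE \<omega> in M. Y 0 \<omega> = 0"
    using X_0 eq by eventually_elim simp
  show "AE \<omega> in M. cadlag (\<lambda>t. Y t \<omega>)"
    using cadlag_paths eq by eventually_elim (auto elim: cadlag_cong[rotated])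
  show "distr M borel (\<lambda>\<omega>. Y (s + t) \<omega> - Y s \<omega>) = distr M borel (Y t)" if "0 \<le> s" "0 \<le> t" for s t
  proof -
    note [measurable] = meas random_variable_X
    have "distr M borel (\<lambda>\<omega>. Y (s + t) \<omega> - Y s \<omega>) = distr M borel (\<lambda>\<omega>. X (s + t) \<omega> - X s \<omega>)"
      using eq that by (intro distr_cong_AE) (auto elim!: eventually_mono)
    also have "\<dots> = distr M borel (X t)"
      using that by (rule stationary_increments)
    also have "\<dots> = distr M borel (Y t)"
      using eq_at[OF that(2)] that by (intro distr_cong_AE) (auto elim!: eventually_mono)
    finally show ?thesis .
  qed
  fix n :: nat and t :: "nat \<Rightarrow> real"
  assume t: "0 \<le> t 0" "strict_mono_on {..n} t"
  have nonneg: "0 \<le> t i" if "i \<le> n" for i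
    using t that strict_mono_onD[OF t(2), of 0 i] by (cases "i = 0") auto
  show "indep_vars (\<lambda>_. borel) (\<lambda>i \<omega>. Y (t (Suc i)) \<omega> - Y (t i) \<omega>) {..<n}"
  proof (rule indep_vars_AE_cong[OF _ _ _ _ indep_increments[OF t]])
    fix i assume i: "i \<in> {..<n}"
    then have i': "0 \<le> t i" "0 \<le> t (Suc i)" by (auto intro: nonneg)
    show "(\<lambda>\<omega>. Y (t (Suc i)) \<omega> - Y (t i) \<omega>) \<in> borel_measurable M"
      using i' by (intro borel_measurable_diff meas)
    show "(\<lambda>\<omega>. X (t (Suc i)) \<omega> - X (t i) \<omega>) \<in> borel_measurable M"
      using i' by (intro borel_measurable_diff random_variable_X)
    show "AE \<omega> in M. X (t (Suc i)) \<omega> - X (t i) \<omega> = Y (t (Suc i)) \<omega> - Y (t i) \<omega>"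
      using eq i' by (auto elim!: eventually_mono)
  qed simp
qed

text \<open>Paths in a null set containing those that are not cadlag or do not start at 0 are
  replaced by 0, and all paths are set to 0 at nonpositive times. At time 0 this agrees with
  \<open>X\<close> off the null set.\<close>

lemma (in levy_process) regular_modification:
  obtains Y where "regular_levy_process M Y" "AE \<omega> in M. \<forall>t\<ge>0. Y t \<omega> = X t \<omega>"
proof -
  \<comment> \<open>The exceptional set need not be measurable; \<open>N\<close> is a measurable
    null set containing it.\<close>
  obtain N where N: "{\<omega> \<in> space M. \<not> (X 0 \<omega> = 0 \<and> cadlag (\<lambda>t. X t \<omega>))} \<subseteq> N" "N \<in> sets M" "emeasure M N = 0"
    by (rule AE_E[OF AE_conjI[OF X_0 cadlag_paths]])
  define Y where "Y t \<omega> = (if \<omega> \<in> space M - N \<and> 0 < t then X t \<omega> else 0)" for t \<omega>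
  have "AE \<omega> in M. \<omega> \<notin> N"
    using N(2,3) by (intro AE_not_in) (auto simp: null_sets_def)
  then have eq: "AE \<omega> in M. \<forall>t\<ge>0. Y t \<omega> = X t \<omega>"
    using AE_space
  proof eventually_elim
    case (elim \<omega>)
    then have "X 0 \<omega> = 0" using N(1) by auto
    then show ?case using elim by (auto simp: Y_def order_le_less)
  qed
  have meas: "Y t \<in> borel_measurable M" if "0 \<le> t" for t
  proof -
    note [measurable] = random_variable_X[OF that] N(2)
    have "(\<lambda>\<omega>. if \<omega> \<in> space M - N \<and> 0 < t then X t \<omega> else 0) \<in> borel_measurable M"
      by measurable
    then show ?thesis by (simp add: Y_def[abs_def])
  qed
  interpret Y: levy_process M Y
    by (rule levy_process_modification[OF meas eq])
  have "regular_levy_process M Y"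
  proof unfold_locales
    show "Y t \<omega> = 0" if "t \<le> 0" for t \<omega>
      using that by (simp add: Y_def)
    show "((\<lambda>u. Y u \<omega>) \<longlongrightarrow> Y t \<omega>) (at_right t)" for t \<omega>
    proof (cases "\<omega> \<in> space M - N \<and> 0 \<le> t")
      case True
      then have "cadlag (\<lambda>t. X t \<omega>)" "X 0 \<omega> = 0" using N(1) by auto
      then have "((\<lambda>u. X u \<omega>) \<longlongrightarrow> Y t \<omega>) (at_right t)"
        using True by (auto simp: cadlag_def Y_def order_le_less)
      moreover have "\<forall>\<^sub>F u in at_right t. X u \<omega> = Y u \<omega>"
        using True by (auto simp: Y_def eventually_at_filter)
      ultimately show ?thesis by (rule Lim_transform_eventually)
    next
      case False
      have "\<forall>\<^sub>F u in at_right t. Y u \<omega> = 0"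
      proof (cases "0 \<le> t")
        case True
        then show ?thesis using False by (auto simp: Y_def)
      next
        case False
        then show ?thesis by (intro eventually_at_rightI[of t 0]) (auto simp: Y_def)
      qed
      moreover have "Y t \<omega> = 0" using False by (auto simp: Y_def)
      ultimately show ?thesis by (simp add: tendsto_eventually)
    qed
  qed
  then show thesis using eq by (rule that)
qed

text \<open>Transience, polarity and the path integrals depend only on nonnegative times and up to a
  null set, the potential measure only on the one-dimensional laws. This carries the result from the
  regular version back to \<open>X\<close>.\<close>

lemma (in levy_process) modification_invariants:
  assumes "levy_process M Y" and eq: "AE \<omega> in M. \<forall>t\<ge>0. Y t \<omega> = X t \<omega>"
  shows "transient M Y \<longleftrightarrow> transient M X"
    and "zero_polar M Y \<longleftrightarrow> zero_polar M X"
    and "kato_potential M Y = kato_potential M X"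
    and "kato_resolvent M Y = kato_resolvent M X"
    and "kato_semigroup M Y = kato_semigroup M X"
proof -
  interpret Y: levy_process M Y by fact
  show "transient M Y \<longleftrightarrow> transient M X"
    unfolding transient_def
  proof (rule eventually_subst)
    show "AE \<omega> in M. filterlim (\<lambda>t. norm (Y t \<omega>)) at_top at_top \<longleftrightarrow> filterlim (\<lambda>t. norm (X t \<omega>)) at_top at_top"
      using eq
    proof eventually_elim
      case (elim \<omega>)
      have "\<forall>\<^sub>F t in at_top. norm (Y t \<omega>) = norm (X t \<omega>)"
        using eventually_ge_at_top[of 0] by eventually_elim (use elim in simp)
      then show ?case by (rule filterlim_cong[OF refl refl])
    qed
  qed
  show "zero_polar M Y \<longleftrightarrow> zero_polar M X"
    unfolding zero_polar_def AE_from_def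
  proof (intro all_cong1 eventually_subst)
    fix x
    show "AE \<omega> in M. (\<not> (\<exists>t>0. x + Y t \<omega> = 0)) \<longleftrightarrow> (\<not> (\<exists>t>0. x + X t \<omega> = 0))"
      using eq by eventually_elim (auto dest: less_imp_le)
  qed
  have "potential_measure M Y = potential_measure M X"
  proof (rule measure_eqI)
    fix B assume "B \<in> sets (potential_measure M Y)"
    then have B [measurable]: "B \<in> sets borel" by simp
    have "emeasure M {\<omega> \<in> space M. Y u \<omega> \<in> B} = emeasure M {\<omega> \<in> space M. X u \<omega> \<in> B}" if "0 \<le> u" for u
    proof (rule emeasure_eq_AE)
      note [measurable] = random_variable_X[OF that] Y.random_variable_X[OF that]
      show "AE \<omega> in M. \<omega> \<in> {\<omega> \<in> space M. Y u \<omega> \<in> B} \<longleftrightarrow> \<omega> \<in> {\<omega> \<in> space M. X u \<omega> \<in> B}"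
        using eq by eventually_elim (use that in auto)
      show "{\<omega> \<in> space M. Y u \<omega> \<in> B} \<in> sets M" "{\<omega> \<in> space M. X u \<omega> \<in> B} \<in> sets M"
        by measurable
    qed
    then show "emeasure (potential_measure M Y) B = emeasure (potential_measure M X) B"
      unfolding emeasure_potential_measure[OF B] Y.emeasure_potential_measure[OF B]
      by (intro nn_integral_cong) (auto split: split_indicator)
  qed simp
  then show "kato_potential M Y = kato_potential M X"
    by (simp add: kato_potential_def)
  have path: "expectation_from M Y x (\<lambda>Z. \<integral>\<^sup>+u\<in>I. h u (Z u) \<partial>lborel) =
      expectation_from M X x (\<lambda>Z. \<integral>\<^sup>+u\<in>I. h u (Z u) \<partial>lborel)" if "I \<subseteq> {0..}" for x I h
    unfolding expectation_from_def
  proof (rule nn_integral_cong_AE)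
    show "AE \<omega> in M. (\<integral>\<^sup>+u\<in>I. h u (x + Y u \<omega>) \<partial>lborel) = (\<integral>\<^sup>+u\<in>I. h u (x + X u \<omega>) \<partial>lborel)"
      using eq
    proof eventually_elim
      case (elim \<omega>)
      show ?case
        by (intro nn_integral_cong) (use elim that in \<open>auto split: split_indicator\<close>)
    qed
  qed
  have "expectation_from M Y x (\<lambda>Z. \<integral>\<^sup>+u\<in>{0..}. ennreal (exp (- c * u)) * indicator (ball x r) (Z u) *
          ennreal \<bar>q (Z u)\<bar> \<partial>lborel) =
        expectation_from M X x (\<lambda>Z. \<integral>\<^sup>+u\<in>{0..}. ennreal (exp (- c * u)) * indicator (ball x r) (Z u) *
          ennreal \<bar>q (Z u)\<bar> \<partial>lborel)" for x c r q
    by (rule path[of "{0..}" x "\<lambda>u y. ennreal (exp (- c * u)) * indicator (ball x r) y * ennreal \<bar>q y\<bar>"]) simp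
  then show "kato_resolvent M Y = kato_resolvent M X"
    unfolding kato_resolvent_def by simp
  have "expectation_from M Y x (\<lambda>Z. \<integral>\<^sup>+u\<in>{0..t}. ennreal \<bar>q (Z u)\<bar> \<partial>lborel) =
        expectation_from M X x (\<lambda>Z. \<integral>\<^sup>+u\<in>{0..t}. ennreal \<bar>q (Z u)\<bar> \<partial>lborel)" for x t q
    by (rule path[of "{0..t}" x "\<lambda>u y. ennreal \<bar>q y\<bar>"]) auto
  then show "kato_semigroup M Y = kato_semigroup M X"
    unfolding kato_semigroup_def by simp
qed

theorem theorem4p14:
  fixes M :: "'w measure" and X :: "real \<Rightarrow> 'w \<Rightarrow> 'a::euclidean_space"
  assumes "levy_process M X"
    and "transient M X"
    and "zero_polar M X"
    and "tends_to_zero_at_infinity (potential_measure M X)"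
  shows "(\<forall>q \<in> borel_measurable borel.
            q \<in> kato_semigroup M X \<longleftrightarrow>
            ((\<lambda>r. \<Squnion>x. \<integral>\<^sup>+ z\<in>ball 0 r. ennreal \<bar>q (z + x)\<bar> \<partial>potential_measure M X)
              \<longlongrightarrow> 0) (at_right 0)) \<and>
         kato_potential M X = kato_resolvent M X \<and>
         kato_resolvent M X = kato_semigroup M X"
proof -
  interpret levy_process M X by fact
  obtain Y where Y: "regular_levy_process M Y" and eq: "AE \<omega> in M. \<forall>t\<ge>0. Y t \<omega> = X t \<omega>"
    by (rule regular_modification)
  interpret Y: regular_levy_process M Y by fact
  note inv = modification_invariants[OF Y.levy_process_axioms eq]
  have "kato_potential M X = kato_resolvent M X" "kato_resolvent M X = kato_semigroup M X"
    using Y.kato_classes_eq assms(2,3) unfolding inv by auto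
  \<comment> \<open>Membership in \<open>kato_potential\<close> is the displayed limit, so the
    equivalence follows from the equality of the classes.\<close>
  moreover have "q \<in> kato_semigroup M X \<longleftrightarrow>
      ((\<lambda>r. \<Squnion>x. \<integral>\<^sup>+ z\<in>ball 0 r. ennreal \<bar>q (z + x)\<bar> \<partial>potential_measure M X) \<longlongrightarrow> 0) (at_right 0)"
    if "q \<in> borel_measurable borel" for q
    using that by (simp add: calculation[symmetric] kato_potential_def)
  ultimately show ?thesis by blast
qed

end
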